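(* Consider a coalescing skip-free process on $\mathbb{Z}$ with every site initially occupied, run for a fixed time $T>0$. Suppose that $$\sum_{d=1}^{\infty} d^N\,\sup_{a\in\mathbb{Z}}\,\mathbb{P}\big(X_a\ge X_{a+d}\big)<\infty\qquad\text{for every } N\ge 0,$$ where $X_a$ and $X_{a+d}$ are the time-$T$ positions of independent particles (independent copies of the underlying process) started at $a$ and $a+d$. Let $N_L$ be the number of walls in the interval $[0,L]$ at time $T$, and let $\kappa_k(N_L)$ be its $k$-th cumulant. Then for each fixed $k\ge 2$, $$\kappa_k(N_L)=O(L)\qquad\text{as } L\to\infty .$$
   Context: Skip-free process on $\mathbb{Z}$: a Markov process (discrete or continuous time) describing the motion of one particle on $\mathbb{Z}$ with nearest-neighbor transitions, such that particles cannot change order without first meeting (occupying the same position at the same time). Transition probabilities may be inhomogeneous in both space and time. Coalescing system with every site initially occupied (maximal entrance law): one particle starts from each site of $\mathbb{Z}$ at time $0$; particles move as independent copies of the underlying process until they meet; when two particles meet they merge and continue as one. The basin of a survivor $y$ at time $T$ is the contiguous set of initial positions whose particle has coalesced with $y$ by time $T$. A wall is a boundary between two adjacent basins, i.e. an element of $\mathbb{Z}+\tfrac12$. *)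

theory Defs
  imports "HOL-Probability.Probability" "HOL-Library.Landau_Symbols"
begin

section \<open>Skip-free Markov processes on the integers\<close>

text \<open>
  Times are reals. The time set \<open>TT\<close> is \<open>\<nat>\<close> (discrete time) or \<open>{0..}\<close> (continuous time), and
  \<open>P s t x\<close> is the law at time \<open>t\<close> of a particle that is at \<open>x\<close> at time \<open>s\<close>; it may depend on
  \<open>s\<close>, \<open>t\<close> and \<open>x\<close> in an arbitrary way (no homogeneity in space or time).
\<close>

definition transition_function :: "real set \<Rightarrow> (real \<Rightarrow> real \<Rightarrow> int \<Rightarrow> int pmf) \<Rightarrow> bool" where
  "transition_function TT P \<longleftrightarrow>
     (\<forall>s\<in>TT. \<forall>x. P s s x = return_pmf x) \<and>
     (\<forall>s\<in>TT. \<forall>t\<in>TT. \<forall>u\<in>TT. \<forall>x. s \<le> t \<longrightarrow> t \<le> u \<longrightarrow> bind_pmf (P s t x) (P t u) = P s u x)"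

text \<open>
  The Markov property, through finite-dimensional distributions. The case \<open>n = 0\<close> says that the
  process is at \<open>a\<close> at time \<open>0\<close> almost surely.
\<close>

definition markov_from ::
  "'w measure \<Rightarrow> real set \<Rightarrow> (real \<Rightarrow> real \<Rightarrow> int \<Rightarrow> int pmf) \<Rightarrow> int \<Rightarrow> (real \<Rightarrow> 'w \<Rightarrow> int) \<Rightarrow> bool" where
  "markov_from M TT P a Z \<longleftrightarrow>
     (\<forall>t\<in>TT. Z t \<in> measurable M (count_space UNIV)) \<and>
     (\<forall>n (\<tau> :: nat \<Rightarrow> real) (x :: nat \<Rightarrow> int).
        \<tau> 0 = 0 \<longrightarrow> x 0 = a \<longrightarrow> (\<forall>i\<le>n. \<tau> i \<in> TT) \<longrightarrow> (\<forall>i<n. \<tau> i \<le> \<tau> (Suc i)) \<longrightarrow>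
        measure M {\<omega> \<in> space M. \<forall>i\<le>n. Z (\<tau> i) \<omega> = x i}
          = (\<Prod>i<n. pmf (P (\<tau> i) (\<tau> (Suc i)) (x i)) (x (Suc i))))"

text \<open>
  In continuous time a path is right-continuous with left limits (for the discrete topology of
  \<^typ>\<open>int\<close>) and every jump has size one; in particular there are finitely many jumps in bounded time.
\<close>

definition nearest_neighbour_path :: "real set \<Rightarrow> (real \<Rightarrow> int) \<Rightarrow> bool" where
  "nearest_neighbour_path TT f \<longleftrightarrow>
     TT = \<nat> \<and> (\<forall>n\<in>\<nat>. \<bar>f (n + 1) - f n\<bar> \<le> 1) \<or>
     TT = {0..} \<and> (\<forall>t\<ge>0. continuous (at_right t) f) \<and>
       (\<forall>t>0. \<exists>l. (f \<longlongrightarrow> l) (at_left t) \<and> \<bar>f t - l\<bar> \<le> 1)"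

text \<open>
  \<open>X a\<close> is the copy of the process started at \<open>a\<close>; the copies are independent as whole paths. The
  last clause (no change of order without meeting) does not follow from the nearest-neighbour
  property: in discrete time, for instance, two neighbours could swap places in one step.
\<close>

definition independent_skip_free_copies ::
  "'w measure \<Rightarrow> real set \<Rightarrow> (real \<Rightarrow> real \<Rightarrow> int \<Rightarrow> int pmf) \<Rightarrow> (int \<Rightarrow> real \<Rightarrow> 'w \<Rightarrow> int) \<Rightarrow> bool" where
  "independent_skip_free_copies M TT P X \<longleftrightarrow>
     transition_function TT P \<and>
     (\<forall>a. markov_from M TT P a (X a)) \<and>
     (\<forall>a. AE \<omega> in M. nearest_neighbour_path TT (\<lambda>t. X a t \<omega>)) \<and>
     prob_space.indep_vars M (\<lambda>_. Pi\<^sub>M TT (\<lambda>_. count_space UNIV)) (\<lambda>a \<omega>. \<lambda>t\<in>TT. X a t \<omega>) UNIV \<and>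
     (\<forall>a b. a < b \<longrightarrow>
        (AE \<omega> in M. \<forall>t\<in>TT. X b t \<omega> \<le> X a t \<omega> \<longrightarrow> (\<exists>s\<in>TT. s \<le> t \<and> X a s \<omega> = X b s \<omega>)))"

section \<open>The coalescing system\<close>

text \<open>
  The free paths \<open>x a\<close> are turned into coalescing paths \<open>y a\<close>, using an injective rank \<open>r\<close> to decide
  whose path is continued after a merger. Particle \<open>a\<close> follows its own free path until this first
  meets the trajectory of a particle of smaller rank, and from then on it moves with that particle.
  If several particles of smaller rank are met at that first time, they have already merged, so it
  does not matter which of them is followed.
\<close>

definition coalescing_paths ::
  "real set \<Rightarrow> (int \<Rightarrow> nat) \<Rightarrow> (int \<Rightarrow> real \<Rightarrow> int) \<Rightarrow> (int \<Rightarrow> real \<Rightarrow> int) \<Rightarrow> bool" where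
  "coalescing_paths TT r x y \<longleftrightarrow>
     (\<forall>a. \<forall>t\<in>TT. (\<forall>s\<in>TT. s \<le> t \<longrightarrow> (\<forall>b. r b < r a \<longrightarrow> x a s \<noteq> y b s)) \<longrightarrow> y a t = x a t) \<and>
     (\<forall>a b. \<forall>s\<in>TT. r b < r a \<longrightarrow> x a s = y b s \<longrightarrow>
        (\<forall>u\<in>TT. u < s \<longrightarrow> (\<forall>c. r c < r a \<longrightarrow> x a u \<noteq> y c u)) \<longrightarrow>
        (\<forall>t\<in>TT. s \<le> t \<longrightarrow> y a t = y b t))"

text \<open>\<open>Y a\<close> is the trajectory of the particle started at \<open>a\<close>; every site is initially occupied.\<close>

definition coalescing_system ::
  "'w measure \<Rightarrow> real set \<Rightarrow> (int \<Rightarrow> real \<Rightarrow> 'w \<Rightarrow> int) \<Rightarrow> (int \<Rightarrow> real \<Rightarrow> 'w \<Rightarrow> int) \<Rightarrow> bool" where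
  "coalescing_system M TT X Y \<longleftrightarrow>
     (\<forall>a. \<forall>t\<in>TT. Y a t \<in> measurable M (count_space UNIV)) \<and>
     (\<exists>r :: int \<Rightarrow> nat. inj r \<and>
        (AE \<omega> in M. coalescing_paths TT r (\<lambda>a t. X a t \<omega>) (\<lambda>a t. Y a t \<omega>)))"

section \<open>Basins, walls and cumulants\<close>

text \<open>
  Here \<open>y a\<close> is the position at the observation time of the particle started at \<open>a\<close>; two particles
  have coalesced by that time iff these positions agree, so a survivor is named by its position.
\<close>

definition basin :: "(int \<Rightarrow> int) \<Rightarrow> int \<Rightarrow> int set" where
  "basin y v = {a. y a = v}"

definition walls :: "(int \<Rightarrow> int) \<Rightarrow> real set" where
  "walls y = {w. \<exists>i v v'. v \<noteq> v' \<and> i \<in> basin y v \<and> i + 1 \<in> basin y v' \<and> w = of_int i + 1 / 2}"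

definition num_walls :: "(int \<Rightarrow> int) \<Rightarrow> real \<Rightarrow> nat" where
  "num_walls y L = card (walls y \<inter> {0..L})"

text \<open>
  Derivatives at \<open>0\<close> of the cumulant generating function; meant for random variables with
  exponential moments near \<open>0\<close>, in particular bounded ones.
\<close>

definition cumulant :: "'w measure \<Rightarrow> nat \<Rightarrow> ('w \<Rightarrow> real) \<Rightarrow> real" where
  "cumulant M k Z = (deriv ^^ k) (\<lambda>\<theta>. ln (\<integral>\<omega>. exp (\<theta> * Z \<omega>) \<partial>M)) 0"

end

theory Submission
  imports Defs
begin

text \<open>
  The walls are mixing at a rate faster than every power of the distance, and a family of indicators
  with this property has partial sums whose cumulants grow at most linearly.

  Mixing. Coalescing particles started from two sets \<open>F\<close> and \<open>G\<close> of sites evolve independently until a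
  particle of one set meets a particle of the other. Two independent particles meet with
  probability at most twice the probability \<open>P(X\<^sub>a \<ge> X\<^sub>b)\<close> that their order is weakly reversed at time
  \<open>T\<close>: from the meeting on they have the same law, so that the order is weakly reversed with conditional
  probability at least one half (\<open>meeting_prob_reflection\<close>). Hence the covariance of an event for \<open>F\<close>
  and an event for \<open>G\<close> is bounded by the sum of \<open>2 P(X\<^sub>a \<ge> X\<^sub>b)\<close> over the pairs
  (\<open>coalescing_system_decoupling\<close>), and the summability hypothesis makes it smaller than every power of
  the distance of the two sets (\<open>wall_moment_mixing\<close>).

  The law of the coalescing system. In the given construction a particle follows free paths of
  particles of smaller and smaller rank, which may start anywhere, also inside or beyond the other
  set. On a finite time grid this is no obstacle: merging by rank has the same law as
  letting every occupied site draw one arrow for all particles on it, independently of the other sites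
  (\<open>follow_leaders_chain_law\<close>), and in this description particles can be dropped without changing the law
  of the others (\<open>coalescing_flow_restr\<close>). In continuous time the paths are integer-valued and right-continuous, hence a fine
  enough grid, and in discrete time the grid of all integer times, reproduces the positions at time \<open>T\<close> exactly (\<open>coalescing_paths_on_grid\<close>), and the
  covariance bound, which is uniform in the grid, passes to the limit.

  Cumulants. The \<open>k\<close>-th cumulant of a sum of indicators is the sum of the joint cumulants over all
  \<open>k\<close>-tuples of indices (\<open>tuple_sum_moment_recursion\<close>, \<open>cumulant_moment_recursion\<close>). A joint cumulant is
  small if its indices fall into two distant groups, because it vanishes for independent groups
  (\<open>joint_cumulant_cluster\<close>). A tuple of large diameter has a large gap, so joint cumulants decay fast in
  the diameter (\<open>joint_cumulant_decay\<close>), and the sum over all tuples with a given first index is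
  bounded (\<open>tuple_sum_joint_cumulant_linear\<close>). Summing over the first index gives the factor \<open>L\<close>.
\<close>

section \<open>Joint cumulants as a recursion over lists\<close>

text \<open>
  All ways of dividing a list of indices into a sublist and the complementary sublist. Lists take
  the place of tuples with a distinguished set of positions, so that sums over tuples of indices can
  be treated by recursion, repetitions of an index included.
\<close>

fun list_splits :: "'a list \<Rightarrow> ('a list \<times> 'a list) list" where
  "list_splits [] = [([], [])]"
| "list_splits (x # xs) =
     map (\<lambda>s. (x # fst s, snd s)) (list_splits xs) @ map (\<lambda>s. (fst s, x # snd s)) (list_splits xs)"

lemma list_splits_length: "(a, b) \<in> set (list_splits xs) \<Longrightarrow> length a + length b = length xs"
  by (induction xs arbitrary: a b) auto

lemma list_splits_set: "(a, b) \<in> set (list_splits xs) \<Longrightarrow> set a \<union> set b = set xs"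
  by (induction xs arbitrary: a b) (auto, (metis UnE UnI1 UnI2)+)

lemma length_list_splits: "length (list_splits xs) = 2 ^ length xs"
  by (induction xs) auto

text \<open>
  Exactly one splitting leaves nothing on the right; in the recursion below it carries the joint
  cumulant of the whole list.
\<close>

lemma list_splits_full: "filter (\<lambda>s. snd s = []) (list_splits xs) = [(xs, [])]"
  by (induction xs) (auto simp: filter_map o_def)

text \<open>
  For \<open>E [i, j, ...]\<close> the mixed moment of \<open>W\<^sub>i, W\<^sub>j, ...\<close> this is the joint cumulant of these variables.
  The usual formula \<open>E(W\<^sub>x W\<^sub>x\<^sub>s) = \<Sum> \<kappa>(W\<^sub>x, W\<^sub>a) E(W\<^sub>b)\<close>, a sum over the blocks \<open>x, a\<close> that contain the head, is
  solved here for its term with \<open>b\<close> empty; this avoids set partitions altogether.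
\<close>

function joint_cumulant :: "('a list \<Rightarrow> real) \<Rightarrow> 'a list \<Rightarrow> real" where
  "joint_cumulant E [] = 0"
| "joint_cumulant E (x # xs) = E (x # xs) -
     (\<Sum>s\<leftarrow>filter (\<lambda>s. snd s \<noteq> []) (list_splits xs). joint_cumulant E (x # fst s) * E (snd s))"
  by pat_completeness auto
termination
proof (relation "inv_image less_than (length \<circ> snd)", goal_cases)
  case (2 E x xs s)
  then have "(fst s, snd s) \<in> set (list_splits xs)" "snd s \<noteq> []"
    by auto
  with list_splits_length[of "fst s" "snd s" xs] show ?case
    by (cases "snd s") auto
qed auto

\<comment> \<open>The equation calls itself under the sum, so as a rewrite rule it would unfold without end.\<close>
declare joint_cumulant.simps(2) [simp del]

lemma sum_list_filter_split:
  fixes f :: "'a \<Rightarrow> real"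
  shows "(\<Sum>s\<leftarrow>ss. f s) = (\<Sum>s\<leftarrow>filter P ss. f s) + (\<Sum>s\<leftarrow>filter (\<lambda>s. \<not> P s) ss. f s)"
  by (induction ss) auto

lemma moment_conv_joint_cumulant:
  assumes "E [] = 1"
  shows "E (x # xs) = (\<Sum>s\<leftarrow>list_splits xs. joint_cumulant E (x # fst s) * E (snd s))"
  using sum_list_filter_split[of "\<lambda>s. joint_cumulant E (x # fst s) * E (snd s)" "list_splits xs"
      "\<lambda>s. snd s = []"] assms
  by (simp add: list_splits_full joint_cumulant.simps(2)[of E x xs])

text \<open>
  The sum over all \<open>n\<close>-tuples of indices, by recursion on the length, so that it can be interchanged with the
  splitting of a list one entry at a time.
\<close>

primrec tuple_sum :: "'a set \<Rightarrow> nat \<Rightarrow> ('a list \<Rightarrow> real) \<Rightarrow> real" where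
  "tuple_sum I 0 f = f []"
| "tuple_sum I (Suc n) f = (\<Sum>x\<in>I. tuple_sum I n (\<lambda>xs. f (x # xs)))"

lemma tuple_sum_add: "tuple_sum I n (\<lambda>xs. f xs + g xs) = tuple_sum I n f + tuple_sum I n g"
  by (induction n arbitrary: f g) (auto simp: sum.distrib)

lemma tuple_sum_cmult: "tuple_sum I n (\<lambda>xs. c * f xs) = c * tuple_sum I n f"
  by (induction n arbitrary: f) (auto simp: sum_distrib_left)

lemma tuple_sum_abs_le:
  assumes "\<And>xs. length xs = n \<Longrightarrow> \<bar>f xs\<bar> \<le> g xs"
  shows "\<bar>tuple_sum I n f\<bar> \<le> tuple_sum I n g"
  using assms
proof (induction n arbitrary: f g)
  case (Suc n)
  have "\<bar>tuple_sum I (Suc n) f\<bar> \<le> (\<Sum>x\<in>I. \<bar>tuple_sum I n (\<lambda>xs. f (x # xs))\<bar>)"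
    by simp
  also have "\<dots> \<le> (\<Sum>x\<in>I. tuple_sum I n (\<lambda>xs. g (x # xs)))"
    by (intro sum_mono Suc.IH Suc.prems) auto
  finally show ?case
    by simp
qed auto

lemma tuple_sum_prod_list:
  "tuple_sum I n (\<lambda>xs. \<Prod>x\<leftarrow>xs. w x) = (\<Sum>x\<in>I. w x) ^ n"
  by (induction n) (auto simp: tuple_sum_cmult sum_distrib_right)

lemma pascal_sum:
  fixes u v :: "nat \<Rightarrow> real"
  shows "(\<Sum>j\<le>n. real (n choose j) * u (Suc j) * v (n - j))
       + (\<Sum>j\<le>n. real (n choose j) * u j * v (Suc (n - j)))
       = (\<Sum>j\<le>Suc n. real (Suc n choose j) * u j * v (Suc n - j))"
proof -
  have "(\<Sum>j\<le>n. real (n choose j) * u j * v (Suc (n - j)))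
      = (\<Sum>j\<le>Suc n. real (n choose j) * u j * v (Suc n - j))"
    by (simp add: Suc_diff_le)
  also have "\<dots> = u 0 * v (Suc n) + (\<Sum>j\<le>n. real (n choose Suc j) * u (Suc j) * v (n - j))"
    by (subst sum.atMost_Suc_shift) simp
  finally have "(\<Sum>j\<le>n. real (n choose j) * u (Suc j) * v (n - j))
       + (\<Sum>j\<le>n. real (n choose j) * u j * v (Suc (n - j)))
       = u 0 * v (Suc n) + (\<Sum>j\<le>n. real (Suc n choose Suc j) * u (Suc j) * v (n - j))"
    by (simp add: algebra_simps sum.distrib)
  also have "\<dots> = (\<Sum>j\<le>Suc n. real (Suc n choose j) * u j * v (Suc n - j))"
    by (subst sum.atMost_Suc_shift) simp
  finally show ?thesis .
qed

text \<open>
  The \<open>n\<close> positions of a tuple are divided into \<open>j\<close> positions for \<open>f\<close> and \<open>n - j\<close> for \<open>g\<close>, and the entries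
  at all positions range freely over \<open>I\<close>; only the number \<open>j\<close> matters, which gives the binomial
  coefficient.
\<close>

lemma tuple_sum_splits:
  "tuple_sum I n (\<lambda>xs. \<Sum>s\<leftarrow>list_splits xs. f (fst s) * g (snd s))
   = (\<Sum>j\<le>n. real (n choose j) * tuple_sum I j f * tuple_sum I (n - j) g)"
proof (induction n arbitrary: f g)
  case (Suc n)
  have "tuple_sum I (Suc n) (\<lambda>xs. \<Sum>s\<leftarrow>list_splits xs. f (fst s) * g (snd s))
    = (\<Sum>x\<in>I. tuple_sum I n (\<lambda>xs. \<Sum>s\<leftarrow>list_splits xs. f (x # fst s) * g (snd s))
           + tuple_sum I n (\<lambda>xs. \<Sum>s\<leftarrow>list_splits xs. f (fst s) * g (x # snd s)))"
    by (simp add: tuple_sum_add[symmetric] o_def)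
  also have "\<dots> = (\<Sum>j\<le>n. real (n choose j) * tuple_sum I (Suc j) f * tuple_sum I (n - j) g)
      + (\<Sum>j\<le>n. real (n choose j) * tuple_sum I j f * tuple_sum I (Suc (n - j)) g)"
    unfolding sum.distrib Suc.IH[of "\<lambda>a. f (x # a)" g for x] Suc.IH[of f "\<lambda>b. g (x # b)" for x]
    by (subst (1 2) sum.swap) (simp add: sum_distrib_left sum_distrib_right)
  also have "\<dots> = (\<Sum>j\<le>Suc n. real (Suc n choose j) * tuple_sum I j f * tuple_sum I (Suc n - j) g)"
    by (rule pascal_sum)
  finally show ?case .
qed auto

text \<open>
  Summed over all tuples, the recursion for joint cumulants turns into the recursion that links the
  moments \<open>m\<^sub>n\<close> and the cumulants \<open>\<kappa>\<^sub>n\<close> of a single random variable,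
  \<open>m\<^sub>n\<^sub>+\<^sub>1 = \<Sum>\<^sub>j (n choose j) \<kappa>\<^sub>j\<^sub>+\<^sub>1 m\<^sub>n\<^sub>-\<^sub>j\<close>. This is the multilinearity of cumulants in the form in which it is used:
  the cumulants of a sum are sums of joint cumulants.
\<close>

lemma tuple_sum_moment_recursion:
  assumes "E [] = 1"
  shows "tuple_sum I (Suc n) E
    = (\<Sum>j\<le>n. real (n choose j) * tuple_sum I (Suc j) (joint_cumulant E) * tuple_sum I (n - j) E)"
proof -
  have "tuple_sum I (Suc n) E = (\<Sum>x\<in>I. tuple_sum I n
      (\<lambda>xs. \<Sum>s\<leftarrow>list_splits xs. joint_cumulant E (x # fst s) * E (snd s)))"
    by (simp add: moment_conv_joint_cumulant[where E = E, OF assms])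
  also have "\<dots> = (\<Sum>j\<le>n. real (n choose j) * tuple_sum I (Suc j) (joint_cumulant E) * tuple_sum I (n - j) E)"
    unfolding tuple_sum_splits[of I n "\<lambda>a. joint_cumulant E (x # a)" E for x]
    by (subst sum.swap) (simp add: sum_distrib_left sum_distrib_right)
  finally show ?thesis .
qed

text \<open>
  As \<open>m 0 = 1\<close>, the last summand of the recursion is \<open>c (Suc n)\<close> itself, so the moments determine the
  cumulants.
\<close>

lemma cumulant_recursion_unique:
  fixes c c' m :: "nat \<Rightarrow> real"
  assumes "m 0 = 1"
    and "\<And>n. m (Suc n) = (\<Sum>j\<le>n. real (n choose j) * c (Suc j) * m (n - j))"
    and "\<And>n. m (Suc n) = (\<Sum>j\<le>n. real (n choose j) * c' (Suc j) * m (n - j))"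
  shows "c (Suc n) = c' (Suc n)"
proof (induction n rule: less_induct)
  case (less n)
  have "(\<Sum>j<n. real (n choose j) * c (Suc j) * m (n - j)) + c (Suc n)
      = (\<Sum>j<n. real (n choose j) * c' (Suc j) * m (n - j)) + c' (Suc n)"
    using assms(2)[of n] assms(3)[of n] by (simp add: lessThan_Suc_atMost[symmetric] assms(1))
  moreover have "(\<Sum>j<n. real (n choose j) * c (Suc j) * m (n - j))
      = (\<Sum>j<n. real (n choose j) * c' (Suc j) * m (n - j))"
    using less by (intro sum.cong) auto
  ultimately show ?case
    by simp
qed

lemma abs_sum_list_le:
  fixes f :: "'a \<Rightarrow> real"
  assumes "\<And>s. s \<in> set ss \<Longrightarrow> \<bar>f s\<bar> \<le> B" "length ss \<le> n" "B \<ge> 0"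
  shows "\<bar>\<Sum>s\<leftarrow>ss. f s\<bar> \<le> real n * B"
proof -
  have "\<bar>\<Sum>s\<leftarrow>ss. f s\<bar> \<le> real (length ss) * B"
    using assms(1)
  proof (induction ss)
    case (Cons s ss)
    have "\<bar>f s + (\<Sum>s\<leftarrow>ss. f s)\<bar> \<le> B + real (length ss) * B"
      using Cons by (intro order_trans[OF abs_triangle_ineq] add_mono) auto
    then show ?case
      by (simp add: algebra_simps)
  qed simp
  also have "\<dots> \<le> real n * B"
    using assms by (intro mult_right_mono) auto
  finally show ?thesis .
qed

section \<open>Joint cumulants of nearly independent groups\<close>

text \<open>
  Only the number of terms and the bounds on shorter lists enter, so the bound is uniform in the indices
  and hence in the interval from which they are later taken.
\<close>

lemma joint_cumulant_bounded:
  assumes "\<And>xs. \<bar>E xs\<bar> \<le> 1"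
  shows "\<exists>B\<ge>0. \<forall>xs. length xs \<le> k \<longrightarrow> \<bar>joint_cumulant E xs\<bar> \<le> B"
proof (induction k)
  case 0
  show ?case
    by (intro exI[of _ 0]) auto
next
  case (Suc k)
  then obtain B where B: "B \<ge> 0" "\<And>xs. length xs \<le> k \<Longrightarrow> \<bar>joint_cumulant E xs\<bar> \<le> B"
    by blast
  have "\<bar>joint_cumulant E xs\<bar> \<le> 1 + real (2 ^ k) * B" if "length xs \<le> Suc k" for xs
  proof (cases xs)
    case (Cons x zs)
    define ss where "ss = filter (\<lambda>s. snd s \<noteq> []) (list_splits zs)"
    have "\<bar>\<Sum>s\<leftarrow>ss. joint_cumulant E (x # fst s) * E (snd s)\<bar> \<le> real (2 ^ k) * B"
    proof (rule abs_sum_list_le)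
      fix s assume "s \<in> set ss"
      then have s: "(fst s, snd s) \<in> set (list_splits zs)" "snd s \<noteq> []"
        by (auto simp: ss_def)
      have "length (x # fst s) \<le> k"
        using list_splits_length[OF s(1)] s(2) that Cons by (cases "snd s") auto
      then have "\<bar>joint_cumulant E (x # fst s)\<bar> * \<bar>E (snd s)\<bar> \<le> B * 1"
        using assms B by (intro mult_mono) auto
      then show "\<bar>joint_cumulant E (x # fst s) * E (snd s)\<bar> \<le> B"
        by (simp add: abs_mult)
    next
      have "length ss \<le> 2 ^ length zs"
        unfolding ss_def length_list_splits[symmetric] by (rule length_filter_le)
      also have "\<dots> \<le> 2 ^ k"
        using that Cons by (intro power_increasing) auto
      finally show "length ss \<le> 2 ^ k" .
    qed (use B in auto)
    moreover have "joint_cumulant E xs = E xs - (\<Sum>s\<leftarrow>ss. joint_cumulant E (x # fst s) * E (snd s))"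
      unfolding Cons ss_def by (rule joint_cumulant.simps)
    ultimately show ?thesis
      using assms[of xs] by linarith
  qed (use B in auto)
  then show ?case
    using B by (intro exI[of _ "1 + real (2 ^ k) * B"]) auto
qed

text \<open>
  Splittings whose left part lies in \<open>Q\<close> arise from splittings of the \<open>Q\<close>-part of the list, the other
  entries all going to the right.
\<close>

lemma sum_splits_filter:
  fixes f g :: "'a list \<Rightarrow> real"
  shows "(\<Sum>s\<leftarrow>list_splits zs. if list_all Q (fst s) then f (fst s) * g (filter Q (snd s)) else 0)
       = (\<Sum>s\<leftarrow>list_splits (filter Q zs). f (fst s) * g (snd s))"
proof (induction zs arbitrary: f g)
  case (Cons z zs)
  show ?case
    using Cons.IH[of "\<lambda>a. f (z # a)" g] Cons.IH[of f "\<lambda>b. g (z # b)"] Cons.IH[of f g]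
    by (cases "Q z") (simp_all add: o_def cong: if_cong)
qed auto

lemma list_splits_filter_not:
  "(a, b) \<in> set (list_splits zs) \<Longrightarrow> list_all Q a \<Longrightarrow>
    filter (\<lambda>x. \<not> Q x) b = filter (\<lambda>x. \<not> Q x) zs"
  by (induction zs arbitrary: a b) auto

definition factor_error :: "('a list \<Rightarrow> real) \<Rightarrow> ('a \<Rightarrow> bool) \<Rightarrow> 'a list \<Rightarrow> real" where
  "factor_error E Q ys = \<bar>E ys - E (filter Q ys) * E (filter (\<lambda>x. \<not> Q x) ys)\<bar>"

lemma factor_error_not: "factor_error E (\<lambda>x. \<not> Q x) ys = factor_error E Q ys"
  by (simp add: factor_error_def mult.commute)

text \<open>
  If the two groups were independent, the joint cumulant of a list that meets both would vanish. The
  same induction works with an error. Let the head lie in \<open>Q\<close>, and consider the splittings in the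
  recursion. If the left part leaves \<open>Q\<close>, its cumulant is small by induction. If it stays in
  \<open>Q\<close>, the moment of the right part nearly factorises, and these terms add up, by the recursion for
  the \<open>Q\<close>-part alone, to the product of the moments of the two groups; that product nearly cancels the
  moment of the whole list.
\<close>

lemma joint_cumulant_cluster:
  assumes E: "E [] = 1" "\<And>xs. \<bar>E xs\<bar> \<le> 1"
  shows "\<exists>C\<ge>0. \<forall>xs Q \<delta>. length xs \<le> k \<longrightarrow> (\<exists>x\<in>set xs. Q x) \<longrightarrow> (\<exists>x\<in>set xs. \<not> Q x) \<longrightarrow>
     (\<forall>ys. set ys \<subseteq> set xs \<longrightarrow> length ys \<le> k \<longrightarrow> factor_error E Q ys \<le> \<delta>) \<longrightarrow>
     \<bar>joint_cumulant E xs\<bar> \<le> C * \<delta>"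
proof (induction k)
  case 0
  show ?case
    by (intro exI[of _ 0]) auto
next
  case (Suc k)
  obtain B where B: "B \<ge> 0" "\<And>xs. length xs \<le> k \<Longrightarrow> \<bar>joint_cumulant E xs\<bar> \<le> B"
    using joint_cumulant_bounded[of E k] E(2) by blast
  from Suc obtain C where C: "C \<ge> 0" "\<And>xs Q \<delta>. length xs \<le> k \<Longrightarrow> \<exists>x\<in>set xs. Q x \<Longrightarrow>
      \<exists>x\<in>set xs. \<not> Q x \<Longrightarrow> (\<And>ys. set ys \<subseteq> set xs \<Longrightarrow> length ys \<le> k \<Longrightarrow> factor_error E Q ys \<le> \<delta>) \<Longrightarrow>
      \<bar>joint_cumulant E xs\<bar> \<le> C * \<delta>"
    by blast
  have main: "\<bar>joint_cumulant E (x # zs)\<bar> \<le> (1 + real (2 ^ k) * (B + C)) * \<delta>"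
    if len: "length zs \<le> k" and x: "Q x" and nQ: "\<exists>z\<in>set zs. \<not> Q z"
      and err: "\<And>ys. set ys \<subseteq> set (x # zs) \<Longrightarrow> length ys \<le> Suc k \<Longrightarrow> factor_error E Q ys \<le> \<delta>"
    for x zs Q \<delta>
  proof -
    let ?c = "joint_cumulant E"
    let ?nQ = "filter (\<lambda>x. \<not> Q x) zs"
    have "\<delta> \<ge> 0"
      using err[of "[]"] by (simp add: factor_error_def E)
    define ss where "ss = filter (\<lambda>s. snd s \<noteq> []) (list_splits zs)"
    define G where "G = (\<lambda>s. ?c (x # fst s) * E (snd s))"
    \<comment> \<open>\<open>G\<close> collects the terms of the recursion, and \<open>H\<close> is what they would be if the groups were independent.\<close>
    define H where "H = (\<lambda>s. (if list_all Q (fst s) then ?c (x # fst s) * E (filter Q (snd s)) else 0) * E ?nQ)"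
    have "(\<Sum>s\<leftarrow>list_splits zs. H s)
        = (\<Sum>s\<leftarrow>list_splits zs. if list_all Q (fst s) then ?c (x # fst s) * E (filter Q (snd s)) else 0) * E ?nQ"
      unfolding H_def by (rule sum_list_mult_const)
    also have "\<dots> = E (x # filter Q zs) * E ?nQ"
      unfolding sum_splits_filter[where zs = zs and Q = Q and f = "\<lambda>a. ?c (x # a)" and g = E]
      by (subst moment_conv_joint_cumulant[where E = E, OF E(1), of x]) simp
    finally have H1: "(\<Sum>s\<leftarrow>list_splits zs. H s) = E (x # filter Q zs) * E ?nQ" .
    have "H (zs, []) = 0"
      using nQ by (auto simp: H_def list_all_iff)
    then have H2: "(\<Sum>s\<leftarrow>list_splits zs. H s) = (\<Sum>s\<leftarrow>ss. H s)"
      using sum_list_filter_split[of H "list_splits zs" "\<lambda>s. snd s = []"]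
      by (simp add: list_splits_full ss_def)
    have c: "?c (x # zs) = (E (x # zs) - E (x # filter Q zs) * E ?nQ) + (\<Sum>s\<leftarrow>ss. H s - G s)"
      using H1 H2 by (subst joint_cumulant.simps) (simp add: ss_def G_def sum_list_subtractf)
    have "\<bar>\<Sum>s\<leftarrow>ss. H s - G s\<bar> \<le> real (2 ^ k) * ((B + C) * \<delta>)"
    proof (rule abs_sum_list_le)
      fix s assume "s \<in> set ss"
      then have s: "(fst s, snd s) \<in> set (list_splits zs)" "snd s \<noteq> []"
        by (auto simp: ss_def)
      have lens: "length (x # fst s) \<le> k" "length (snd s) \<le> k"
        using list_splits_length[OF s(1)] s(2) len by (cases "snd s"; simp)+
      have sets: "set (fst s) \<union> set (snd s) = set zs"
        by (rule list_splits_set[OF s(1)])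
      have "\<bar>H s - G s\<bar> \<le> max B C * \<delta>"
      proof (cases "list_all Q (fst s)")
        case True
        have "\<bar>H s - G s\<bar> = \<bar>?c (x # fst s)\<bar> * factor_error E Q (snd s)"
          using True list_splits_filter_not[OF s(1) True]
          by (simp add: H_def G_def factor_error_def abs_mult[symmetric] algebra_simps abs_minus_commute)
        also have "\<dots> \<le> B * \<delta>"
          using lens sets B \<open>\<delta> \<ge> 0\<close> by (intro mult_mono B err) (auto simp: factor_error_def)
        also have "\<dots> \<le> max B C * \<delta>"
          using \<open>\<delta> \<ge> 0\<close> by (intro mult_right_mono) auto
        finally show ?thesis .
      next
        case False
        have "\<bar>?c (x # fst s)\<bar> \<le> C * \<delta>"
          using False sets x by (intro C(2)[of _ Q] lens err) (auto simp: list_all_iff)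
        then have "\<bar>?c (x # fst s)\<bar> * \<bar>E (snd s)\<bar> \<le> (C * \<delta>) * 1"
          using E C \<open>\<delta> \<ge> 0\<close> by (intro mult_mono) auto
        moreover have "\<bar>H s - G s\<bar> = \<bar>?c (x # fst s)\<bar> * \<bar>E (snd s)\<bar>"
          using False by (simp add: H_def G_def abs_mult)
        moreover have "C * \<delta> \<le> max B C * \<delta>"
          using \<open>\<delta> \<ge> 0\<close> by (intro mult_right_mono) auto
        ultimately show ?thesis
          by linarith
      qed
      also have "\<dots> \<le> (B + C) * \<delta>"
        using B C \<open>\<delta> \<ge> 0\<close> by (intro mult_right_mono) auto
      finally show "\<bar>H s - G s\<bar> \<le> (B + C) * \<delta>" .
    next
      have "length ss \<le> 2 ^ length zs"
        unfolding ss_def length_list_splits[symmetric] by (rule length_filter_le)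
      also have "\<dots> \<le> 2 ^ k"
        using len by (intro power_increasing) auto
      finally show "length ss \<le> 2 ^ k" .
    qed (use B C \<open>\<delta> \<ge> 0\<close> in auto)
    moreover have "\<bar>E (x # zs) - E (x # filter Q zs) * E ?nQ\<bar> \<le> \<delta>"
      using err[of "x # zs"] len x by (simp add: factor_error_def)
    ultimately have "\<bar>?c (x # zs)\<bar> \<le> \<delta> + real (2 ^ k) * ((B + C) * \<delta>)"
      unfolding c by linarith
    then show ?thesis
      by (simp add: algebra_simps)
  qed
  have "\<bar>joint_cumulant E xs\<bar> \<le> (1 + real (2 ^ k) * (B + C)) * \<delta>"
    if "length xs \<le> Suc k" "\<exists>x\<in>set xs. Q x" "\<exists>x\<in>set xs. \<not> Q x"
      "\<forall>ys. set ys \<subseteq> set xs \<longrightarrow> length ys \<le> Suc k \<longrightarrow> factor_error E Q ys \<le> \<delta>" for xs Q \<delta>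
  proof (cases xs)
    case (Cons x zs)
    show ?thesis
    proof (cases "Q x")
      case True
      then show ?thesis
        using that Cons unfolding Cons by (intro main[where Q = Q]) auto
    next
      case False
      then show ?thesis
        using that Cons unfolding Cons
        by (intro main[where Q = "\<lambda>x. \<not> Q x"]) (auto simp: factor_error_not)
    qed
  qed (use that in auto)
  then show ?case
    using B C by (intro exI[of _ "1 + real (2 ^ k) * (B + C)"]) auto
qed

section \<open>Linear growth of summed joint cumulants\<close>

text \<open>
  Pigeonhole: among the \<open>k\<close> intervals of length \<open>g\<close> that follow \<open>a\<close>, one contains none of the at most
  \<open>k - 1\<close> other points.
\<close>

lemma int_set_gap:
  fixes S :: "int set"
  assumes "finite S" "card S \<le> k" "a \<in> S" "b \<in> S" "a + int k * g \<le> b" "g \<ge> 1"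
  shows "\<exists>P. a \<le> P \<and> P < b \<and> (\<forall>s\<in>S. s \<le> P \<or> s > P + g)"
proof (rule ccontr)
  assume no_gap: "\<not> ?thesis"
  have "\<exists>s\<in>S. a + int i * g < s \<and> s \<le> a + int i * g + g" if "i < k" for i
  proof -
    have "int i * g < int k * g"
      using that assms(6) by simp
    then have "a \<le> a + int i * g \<and> a + int i * g < b"
      using assms(5,6) by (auto intro: less_le_trans[of _ "a + int k * g"])
    with no_gap show ?thesis
      by (meson not_less)
  qed
  then obtain f where f: "\<And>i. i < k \<Longrightarrow> f i \<in> S \<and> a + int i * g < f i \<and> f i \<le> a + int i * g + g"
    by metis
  have less: "f i < f j" if "i < j" "j < k" for i j
  proof -
    have "(int i + 1) * g \<le> int j * g"
      using that assms(6) by (intro mult_right_mono) auto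
    then show ?thesis
      using f[of i] f[of j] that by (auto simp: algebra_simps)
  qed
  have "inj_on f {..<k}"
    by (intro linorder_inj_onI) (use less in \<open>force+\<close>)
  moreover have "f ` {..<k} \<subseteq> S - {a}"
  proof
    fix s assume "s \<in> f ` {..<k}"
    then obtain i where i: "i < k" "s = f i"
      by auto
    have "0 \<le> int i * g"
      using assms(6) by simp
    then have "a < f i"
      using f[OF i(1)] by linarith
    then show "s \<in> S - {a}"
      using f[OF i(1)] i(2) by auto
  qed
  ultimately have "k \<le> card (S - {a})"
    using assms(1) card_inj_on_le[of f "{..<k}" "S - {a}"] by simp
  moreover have "card (S - {a}) < card S"
    using assms by (intro psubset_card_mono) auto
  ultimately show False
    using assms(2) by simp
qed

text \<open>
  A list of \<open>n + 1\<close> indices of diameter \<open>D\<close> has a gap of order \<open>D / (n + 1)\<close>, so its joint cumulant is at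
  most of order \<open>D\<close> to the power \<open>- 2 n\<close>. This is distributed evenly over the \<open>n\<close> later indices, whose
  distances to the head are all at most \<open>D\<close>; two powers for each make the sum over that index converge.
\<close>

lemma joint_cumulant_decay:
  fixes E :: "int list \<Rightarrow> real"
  assumes E: "E [] = 1" "\<And>xs. \<bar>E xs\<bar> \<le> 1"
    and mix: "\<And>N k. \<exists>C\<ge>0. \<forall>P g ys. g \<ge> 1 \<longrightarrow> length ys \<le> k \<longrightarrow> (\<forall>y\<in>set ys. y \<le> P \<or> y > P + g) \<longrightarrow>
          factor_error E (\<lambda>y. y \<le> P) ys \<le> C / real_of_int g ^ N"
  shows "\<exists>C\<ge>0. \<forall>x xs. length xs = n \<longrightarrow>
           \<bar>joint_cumulant E (x # xs)\<bar> \<le> C * (\<Prod>y\<leftarrow>xs. 1 / (1 + \<bar>real_of_int (y - x)\<bar>) ^ 2)"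
proof -
  define k where "k = Suc n"
  \<comment> \<open>Two powers of the diameter for each index after the head.\<close>
  define N where "N = 2 * n"
  obtain B where B: "B \<ge> 0" "\<And>xs. length xs \<le> k \<Longrightarrow> \<bar>joint_cumulant E xs\<bar> \<le> B"
    using joint_cumulant_bounded[of E k] E(2) by blast
  obtain C1 where C1: "C1 \<ge> 0" "\<And>xs Q \<delta>. length xs \<le> k \<Longrightarrow> \<exists>x\<in>set xs. Q x \<Longrightarrow>
      \<exists>x\<in>set xs. \<not> Q x \<Longrightarrow> (\<And>ys. set ys \<subseteq> set xs \<Longrightarrow> length ys \<le> k \<Longrightarrow> factor_error E Q ys \<le> \<delta>) \<Longrightarrow>
      \<bar>joint_cumulant E xs\<bar> \<le> C1 * \<delta>"
    using joint_cumulant_cluster[of E k] E by blast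
  obtain C2 where C2: "C2 \<ge> 0" "\<And>P g ys. g \<ge> 1 \<Longrightarrow> length ys \<le> k \<Longrightarrow>
      (\<And>y. y \<in> set ys \<Longrightarrow> y \<le> P \<or> y > P + g) \<Longrightarrow>
      factor_error E (\<lambda>y. y \<le> P) ys \<le> C2 / real_of_int g ^ N"
    using mix[of k N] by blast
  define C where "C = (2 * real k) ^ N * (B + C1 * C2)"
  have "\<bar>joint_cumulant E (x # xs)\<bar> \<le> C * (\<Prod>y\<leftarrow>xs. 1 / (1 + \<bar>real_of_int (y - x)\<bar>) ^ 2)"
    if len: "length xs = n" for x xs
  proof -
    define S where "S = set (x # xs)"
    define a b where "a = Min S" and "b = Max S"
    define D where "D = b - a"
    define g where "g = D div int k"
    have S: "finite S" "a \<in> S" "b \<in> S" "\<And>s. s \<in> S \<Longrightarrow> a \<le> s \<and> s \<le> b"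
      unfolding a_def b_def S_def by (auto intro!: Min_in Max_in simp del: set_simps simp: Min_le Max_ge)
    have cardS: "card S \<le> k"
      unfolding S_def using card_length[of "x # xs"] len by (simp add: k_def)
    have D0: "D \<ge> 0"
      using S(2,4) by (auto simp: D_def)
    then have g0: "g \<ge> 0"
      by (simp add: g_def div_int_pos_iff)
    have gk: "int k * g \<le> D" "D < int k * (g + 1)"
    proof -
      have "D = int k * g + D mod int k"
        by (simp add: g_def)
      moreover have "0 \<le> D mod int k" "D mod int k < int k"
        by (simp_all add: k_def)
      ultimately show "int k * g \<le> D" "D < int k * (g + 1)"
        by (auto simp: algebra_simps)
    qed
    have decay: "\<bar>joint_cumulant E (x # xs)\<bar> \<le> C / (1 + real_of_int D) ^ N"
    \<comment> \<open>If \<open>g = 0\<close>, the diameter is less than \<open>k\<close> and the uniform bound \<open>B\<close> suffices.\<close>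
    proof (cases "g \<ge> 1")
      case True
      obtain P where P: "a \<le> P" "P < b" "\<And>s. s \<in> S \<Longrightarrow> s \<le> P \<or> s > P + g"
        using int_set_gap[OF S(1) cardS S(2,3), of g] gk True by (auto simp: D_def)
      have "\<bar>joint_cumulant E (x # xs)\<bar> \<le> C1 * (C2 / real_of_int g ^ N)"
      proof (rule C1(2)[where Q = "\<lambda>y. y \<le> P"])
        show "\<exists>y\<in>set (x # xs). y \<le> P" "\<exists>y\<in>set (x # xs). \<not> y \<le> P"
          using P S unfolding S_def by (meson not_le)+
        fix ys assume ys: "set ys \<subseteq> set (x # xs)" "length ys \<le> k"
        show "factor_error E (\<lambda>y. y \<le> P) ys \<le> C2 / real_of_int g ^ N"
          by (rule C2(2)[OF True ys(2)]) (use ys P in \<open>auto simp: S_def\<close>)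
      qed (use len in \<open>simp add: k_def\<close>)
      moreover have "(1 + real_of_int D) ^ N \<le> (2 * real k * real_of_int g) ^ N"
      proof (rule power_mono)
        have "D + 1 \<le> int k * (2 * g)"
          using gk(2) True mult_left_mono[of "g + 1" "2 * g" "int k"] by linarith
        then have "real_of_int (D + 1) \<le> real_of_int (int k * (2 * g))"
          by (rule of_int_le_iff[THEN iffD2])
        then show "1 + real_of_int D \<le> 2 * real k * real_of_int g"
          by (simp add: algebra_simps)
      qed (use D0 in simp)
      then have "1 / real_of_int g ^ N \<le> (2 * real k) ^ N / (1 + real_of_int D) ^ N"
        using True D0 by (simp add: field_simps power_mult_distrib)
      then have "(C1 * C2) * (1 / real_of_int g ^ N) \<le> (C1 * C2) * ((2 * real k) ^ N / (1 + real_of_int D) ^ N)"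
        using C1(1) C2(1) by (intro mult_left_mono) auto
      moreover have "\<dots> \<le> C / (1 + real_of_int D) ^ N"
        using B(1) D0 by (auto simp: C_def divide_simps algebra_simps)
      ultimately show ?thesis
        by simp
    next
      case False
      with g0 have "g = 0"
        by simp
      then have "D + 1 \<le> int k"
        using gk(2) by simp
      then have "1 + real_of_int D \<le> real k"
        by linarith
      then have "1 + real_of_int D \<le> 2 * real k"
        by simp
      then have "(1 + real_of_int D) ^ N \<le> (2 * real k) ^ N"
        using D0 by (intro power_mono) auto
      then have "B * (1 + real_of_int D) ^ N \<le> (B + C1 * C2) * (2 * real k) ^ N"
        using B(1) C1(1) C2(1) D0 by (intro mult_mono) auto
      then have "B \<le> C / (1 + real_of_int D) ^ N"
        using D0 by (simp add: C_def field_simps)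
      then show ?thesis
        using B(2)[of "x # xs"] len by (simp add: k_def)
    qed
    have "1 / ((1 + real_of_int D) ^ 2) ^ length ys \<le> (\<Prod>y\<leftarrow>ys. 1 / (1 + \<bar>real_of_int (y - x)\<bar>) ^ 2)"
      if "set ys \<subseteq> S" for ys
      using that
    proof (induction ys)
      case (Cons y ys)
      have "\<bar>y - x\<bar> \<le> D"
        using S(4)[of x] S(4)[of y] Cons.prems by (auto simp: S_def D_def)
      then have "\<bar>real_of_int (y - x)\<bar> \<le> real_of_int D"
        by linarith
      then have "1 / (1 + real_of_int D) ^ 2 \<le> 1 / (1 + \<bar>real_of_int (y - x)\<bar>) ^ 2"
        by (intro divide_left_mono power_mono mult_pos_pos zero_less_power) auto
      then have "1 / (1 + real_of_int D) ^ 2 * (1 / ((1 + real_of_int D) ^ 2) ^ length ys)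
          \<le> 1 / (1 + \<bar>real_of_int (y - x)\<bar>) ^ 2 * (\<Prod>y\<leftarrow>ys. 1 / (1 + \<bar>real_of_int (y - x)\<bar>) ^ 2)"
        using Cons D0 by (intro mult_mono) auto
      then show ?case
        by simp
    qed simp
    from this[of xs] have "1 / (1 + real_of_int D) ^ N \<le> (\<Prod>y\<leftarrow>xs. 1 / (1 + \<bar>real_of_int (y - x)\<bar>) ^ 2)"
      using len unfolding S_def N_def power_mult by (metis set_subset_Cons)
    moreover have "C \<ge> 0"
      using B C1 C2 by (simp add: C_def)
    ultimately have "C * (1 / (1 + real_of_int D) ^ N) \<le> C * (\<Prod>y\<leftarrow>xs. 1 / (1 + \<bar>real_of_int (y - x)\<bar>) ^ 2)"
      by (rule mult_left_mono)
    with decay show ?thesis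
      by simp
  qed
  moreover have "C \<ge> 0"
    using B C1 C2 by (simp add: C_def)
  ultimately show ?thesis
    by blast
qed

lemma sum_inverse_square_bounded:
  "\<exists>Z\<ge>0. \<forall>I x. finite I \<longrightarrow> (\<Sum>y\<in>I. 1 / (1 + \<bar>real_of_int (y - x)\<bar>) ^ 2) \<le> Z"
proof -
  define f :: "nat \<Rightarrow> real" where "f = (\<lambda>n. 1 / (1 + real n) ^ 2)"
  have "summable (\<lambda>n. inverse (real (Suc n) ^ 2))"
    by (subst summable_Suc_iff) (rule inverse_power_summable, simp)
  then have f: "summable f"
    by (simp add: f_def field_simps)
  have part: "(\<Sum>y\<in>J. 1 / (1 + \<bar>real_of_int (y - x)\<bar>) ^ 2) \<le> suminf f"
    if "finite J" "inj_on (\<lambda>y. nat \<bar>y - x\<bar>) J" for J x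
  proof -
    have "(\<Sum>y\<in>J. 1 / (1 + \<bar>real_of_int (y - x)\<bar>) ^ 2) = (\<Sum>y\<in>J. f (nat \<bar>y - x\<bar>))"
      by (simp add: f_def)
    also have "\<dots> = sum f ((\<lambda>y. nat \<bar>y - x\<bar>) ` J)"
      using that by (simp add: sum.reindex)
    also have "\<dots> \<le> suminf f"
      using f that by (intro sum_le_suminf) (auto simp: f_def)
    finally show ?thesis .
  qed
  have "(\<Sum>y\<in>I. 1 / (1 + \<bar>real_of_int (y - x)\<bar>) ^ 2) \<le> 2 * suminf f" if "finite I" for I x
  proof -
    \<comment> \<open>On each side of \<open>x\<close> the distance to \<open>x\<close> determines the point.\<close>
    have "I = {y\<in>I. y < x} \<union> {y\<in>I. x \<le> y}"
      by auto
    then have "(\<Sum>y\<in>I. 1 / (1 + \<bar>real_of_int (y - x)\<bar>) ^ 2)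
      = (\<Sum>y\<in>{y\<in>I. y < x}. 1 / (1 + \<bar>real_of_int (y - x)\<bar>) ^ 2)
      + (\<Sum>y\<in>{y\<in>I. x \<le> y}. 1 / (1 + \<bar>real_of_int (y - x)\<bar>) ^ 2)"
      using that by (subst sum.union_disjoint[symmetric]) auto
    also have "\<dots> \<le> suminf f + suminf f"
      using that by (intro add_mono part) (auto simp: inj_on_def)
    finally show ?thesis
      by simp
  qed
  moreover have "suminf f \<ge> 0"
    by (rule suminf_nonneg[OF f]) (simp add: f_def)
  ultimately show ?thesis
    by (intro exI[of _ "2 * suminf f"]) auto
qed

text \<open>
  The first index is free in \<open>I\<close>, and each further index contributes a convergent sum around it.
\<close>

lemma tuple_sum_joint_cumulant_linear:
  fixes E :: "int list \<Rightarrow> real"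
  assumes "E [] = 1" "\<And>xs. \<bar>E xs\<bar> \<le> 1"
    and "\<And>N k. \<exists>C\<ge>0. \<forall>P g ys. g \<ge> 1 \<longrightarrow> length ys \<le> k \<longrightarrow> (\<forall>y\<in>set ys. y \<le> P \<or> y > P + g) \<longrightarrow>
          factor_error E (\<lambda>y. y \<le> P) ys \<le> C / real_of_int g ^ N"
  shows "\<exists>C\<ge>0. \<forall>I. finite I \<longrightarrow> \<bar>tuple_sum I (Suc n) (joint_cumulant E)\<bar> \<le> C * real (card I)"
proof -
  obtain C where C: "C \<ge> 0" "\<And>x xs. length xs = n \<Longrightarrow>
      \<bar>joint_cumulant E (x # xs)\<bar> \<le> C * (\<Prod>y\<leftarrow>xs. 1 / (1 + \<bar>real_of_int (y - x)\<bar>) ^ 2)"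
    using joint_cumulant_decay[of E n, OF assms] by blast
  obtain Z where Z: "Z \<ge> 0" "\<And>I x. finite I \<Longrightarrow> (\<Sum>y\<in>I. 1 / (1 + \<bar>real_of_int (y - x)\<bar>) ^ 2) \<le> Z"
    using sum_inverse_square_bounded by blast
  have "\<bar>tuple_sum I (Suc n) (joint_cumulant E)\<bar> \<le> C * Z ^ n * real (card I)" if "finite I" for I
  proof -
    have "\<bar>tuple_sum I (Suc n) (joint_cumulant E)\<bar>
        \<le> (\<Sum>x\<in>I. \<bar>tuple_sum I n (\<lambda>xs. joint_cumulant E (x # xs))\<bar>)"
      by simp
    also have "\<dots> \<le> (\<Sum>x\<in>I. C * Z ^ n)"
    proof (rule sum_mono)
      fix x
      have "\<bar>tuple_sum I n (\<lambda>xs. joint_cumulant E (x # xs))\<bar>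
          \<le> tuple_sum I n (\<lambda>xs. C * (\<Prod>y\<leftarrow>xs. 1 / (1 + \<bar>real_of_int (y - x)\<bar>) ^ 2))"
        by (intro tuple_sum_abs_le C)
      also have "\<dots> = C * (\<Sum>y\<in>I. 1 / (1 + \<bar>real_of_int (y - x)\<bar>) ^ 2) ^ n"
        by (simp only: tuple_sum_cmult tuple_sum_prod_list)
      also have "\<dots> \<le> C * Z ^ n"
        using Z(2)[OF that] C(1) by (intro mult_left_mono power_mono sum_nonneg) auto
      finally show "\<bar>tuple_sum I n (\<lambda>xs. joint_cumulant E (x # xs))\<bar> \<le> C * Z ^ n" .
    qed
    finally show ?thesis
      by (simp add: mult.commute)
  qed
  then show ?thesis
    using C(1) Z(1) by (intro exI[of _ "C * Z ^ n"]) auto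
qed

section \<open>Cumulants from moments\<close>

lemma (in prob_space) expectation_bounded_nat:
  fixes h :: "nat \<Rightarrow> real"
  assumes S: "S \<in> measurable M (count_space UNIV)" "\<And>\<omega>. \<omega> \<in> space M \<Longrightarrow> S \<omega> \<le> n"
  shows "expectation (\<lambda>\<omega>. h (S \<omega>)) = (\<Sum>v\<le>n. prob {\<omega> \<in> space M. S \<omega> = v} * h v)"
proof -
  have meas: "{\<omega> \<in> space M. S \<omega> = v} \<in> events" for v
    using S(1) by measurable
  have "expectation (\<lambda>\<omega>. h (S \<omega>)) = expectation (\<lambda>\<omega>. \<Sum>v\<le>n. indicator {\<omega> \<in> space M. S \<omega> = v} \<omega> * h v)"
    by (intro Bochner_Integration.integral_cong refl) (use S(2) in \<open>simp add: indicator_def if_distrib sum.delta cong: if_cong\<close>)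
  also have "\<dots> = (\<Sum>v\<le>n. expectation (\<lambda>\<omega>. indicator {\<omega> \<in> space M. S \<omega> = v} \<omega> * h v))"
    by (intro Bochner_Integration.integral_sum) (use meas in \<open>auto intro!: integrable_real_indicator simp: emeasure_eq_measure\<close>)
  also have "\<dots> = (\<Sum>v\<le>n. prob {\<omega> \<in> space M. S \<omega> = v} * h v)"
    using meas by (intro sum.cong refl) simp
  finally show ?thesis .
qed

lemma has_fps_expansion_higher_deriv:
  fixes f :: "'a :: {banach, real_normed_field} \<Rightarrow> 'a"
  assumes "f has_fps_expansion F"
  shows "(deriv ^^ n) f 0 = fact n * fps_nth F n"
proof -
  have "((deriv ^^ n) f) has_fps_expansion ((fps_deriv ^^ n) F)"
    using assms by (induction n) (auto intro: has_fps_expansion_deriv)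
  then have "(deriv ^^ n) f 0 = fps_nth ((fps_deriv ^^ n) F) 0"
    by (auto simp: has_fps_expansion_def eval_fps_at_0 dest: eventually_nhds_x_imp_x)
  then show ?thesis
    by (simp add: fps_0th_higher_deriv)
qed

text \<open>
  The derivative of \<open>ln (mgf)\<close> is \<open>mgf' / mgf\<close>. With \<open>F\<close> and \<open>K\<close> the power series of \<open>mgf\<close> and of this
  quotient, comparing the coefficients of \<open>K F = F'\<close> gives the recursion. As \<open>S\<close> takes finitely many
  values, \<open>mgf\<close> is a finite sum of exponentials and all expansions are elementary.
\<close>

lemma (in prob_space) cumulant_moment_recursion:
  assumes S: "S \<in> measurable M (count_space UNIV)" "\<And>\<omega>. \<omega> \<in> space M \<Longrightarrow> S \<omega> \<le> n0"
  shows "expectation (\<lambda>\<omega>. real (S \<omega>) ^ Suc n)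
    = (\<Sum>j\<le>n. real (n choose j) * cumulant M (Suc j) (\<lambda>\<omega>. real (S \<omega>)) * expectation (\<lambda>\<omega>. real (S \<omega>) ^ (n - j)))"
proof -
  define p where "p = (\<lambda>v. prob {\<omega> \<in> space M. S \<omega> = v})"
  define m where "m = (\<lambda>j. expectation (\<lambda>\<omega>. real (S \<omega>) ^ j))"
  define c where "c = (\<lambda>j. cumulant M j (\<lambda>\<omega>. real (S \<omega>)))"
  define mgf where "mgf = (\<lambda>\<theta>. \<Sum>v\<le>n0. p v * exp (real v * \<theta>))"
  define F where "F = (\<Sum>v\<le>n0. fps_const (p v) * fps_exp (real v))"
  define K where "K = fps_deriv F / F"
  have m: "m j = (\<Sum>v\<le>n0. p v * real v ^ j)" for j
    unfolding m_def p_def by (rule expectation_bounded_nat[OF S])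
  have mgf: "(\<integral>\<omega>. exp (\<theta> * real (S \<omega>)) \<partial>M) = mgf \<theta>" for \<theta>
    unfolding mgf_def p_def
    using expectation_bounded_nat[OF S, of "\<lambda>v. exp (\<theta> * real v)"] by (simp add: mult.commute)
  have nthF: "fps_nth F j = m j / fact j" for j
    by (simp add: F_def fps_sum_nth m sum_divide_distrib)
  have m0: "m 0 = 1"
    by (simp add: m_def prob_space)
  have expF: "mgf has_fps_expansion F"
    unfolding mgf_def F_def by (intro fps_expansion_intros)
  have p0: "p v \<ge> 0" for v
    by (simp add: p_def)
  have mgf_pos: "mgf \<theta> > 0" for \<theta>
  proof -
    have "(\<Sum>v\<le>n0. p v) = 1"
      using m[of 0] m0 by simp
    then have "\<exists>v\<le>n0. p v > 0"
      using p0 sum_nonpos[of "{..n0}" p] by (metis atMost_iff not_le not_one_le_zero)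
    then show ?thesis
      unfolding mgf_def using p0 by (auto intro!: sum_pos2)
  qed
  have deriv_mgf: "mgf field_differentiable at \<theta>" for \<theta>
  proof -
    have "((\<lambda>\<theta>. exp (real v * \<theta>)) has_real_derivative exp (real v * \<theta>) * real v) (at \<theta>)" for v
      by (auto intro!: derivative_eq_intros)
    then have "(\<lambda>\<theta>. exp (real v * \<theta>)) field_differentiable at \<theta>" for v
      by (auto simp: field_differentiable_def)
    then show ?thesis
      unfolding mgf_def by (intro derivative_intros)
  qed
  have "deriv (\<lambda>\<theta>. ln (mgf \<theta>)) = (\<lambda>\<theta>. deriv mgf \<theta> / mgf \<theta>)"
  proof
    fix \<theta>
    have "(mgf has_real_derivative deriv mgf \<theta>) (at \<theta>)"
      using deriv_mgf DERIV_deriv_iff_field_differentiable by blast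
    then have "((\<lambda>\<theta>. ln (mgf \<theta>)) has_real_derivative deriv mgf \<theta> / mgf \<theta>) (at \<theta>)"
      using mgf_pos[of \<theta>] by (auto intro!: derivative_eq_intros)
    then show "deriv (\<lambda>\<theta>. ln (mgf \<theta>)) \<theta> = deriv mgf \<theta> / mgf \<theta>"
      by (rule DERIV_imp_deriv)
  qed
  then have "c (Suc j) = (deriv ^^ j) (\<lambda>\<theta>. deriv mgf \<theta> / mgf \<theta>) 0" for j
    by (simp add: c_def cumulant_def mgf funpow_Suc_right del: funpow.simps)
  moreover have "(\<lambda>\<theta>. deriv mgf \<theta> / mgf \<theta>) has_fps_expansion K"
    unfolding K_def using expF m0 by (intro fps_expansion_intros) (auto simp: nthF)
  ultimately have c: "c (Suc j) = fact j * fps_nth K j" for j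
    by (simp add: has_fps_expansion_higher_deriv)
  have "K * F = fps_deriv F"
  proof -
    have "fps_nth F 0 \<noteq> 0"
      by (simp add: nthF m0)
    then have "fps_deriv F / F = fps_deriv F * inverse F"
      by (simp add: fps_divide_unit)
    then show ?thesis
      using \<open>fps_nth F 0 \<noteq> 0\<close> by (simp add: K_def mult.assoc inverse_mult_eq_1)
  qed
  then have "fps_nth (fps_deriv F) n = (\<Sum>j\<le>n. fps_nth K j * fps_nth F (n - j))"
    by (metis fps_mult_nth atMost_atLeast0)
  then have "real (Suc n) * (m (Suc n) / fact (Suc n)) = (\<Sum>j\<le>n. (c (Suc j) / fact j) * (m (n - j) / fact (n - j)))"
    by (simp add: c nthF)
  moreover have "real (Suc n) * (m (Suc n) / fact (Suc n)) = m (Suc n) / fact n"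
    by (simp del: of_nat_Suc)
  ultimately have "m (Suc n) = fact n * (\<Sum>j\<le>n. (c (Suc j) / fact j) * (m (n - j) / fact (n - j)))"
    by (simp add: field_simps del: of_nat_Suc)
  also have "\<dots> = (\<Sum>j\<le>n. real (n choose j) * c (Suc j) * m (n - j))"
    unfolding sum_distrib_left by (intro sum.cong refl) (simp add: binomial_fact)
  finally show ?thesis
    unfolding m_def c_def .
qed

section \<open>Expectations over discrete distributions\<close>

lemma expectation_bind_pmf:
  fixes f :: "'b \<Rightarrow> real"
  assumes "\<And>y. \<bar>f y\<bar> \<le> B"
  shows "measure_pmf.expectation (bind_pmf p q) f
       = measure_pmf.expectation p (\<lambda>x. measure_pmf.expectation (q x) f)"
  unfolding measure_pmf_bind
  by (subst integral_bind[where K = "count_space UNIV" and B' = 1 and B = B])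
     (use assms measurable_measure_pmf[of q] in \<open>auto simp: measure_pmf.emeasure_space_1\<close>)

lemma prob_bind_pmf:
  "measure_pmf.prob (bind_pmf p q) A = measure_pmf.expectation p (\<lambda>x. measure_pmf.prob (q x) A)"
  using expectation_bind_pmf[of "indicator A" 1 p q] by (simp add: indicator_def)

lemma expectation_pair_pmf_mult:
  fixes f :: "'a \<Rightarrow> real" and g :: "'b \<Rightarrow> real"
  assumes "\<And>x. \<bar>f x\<bar> \<le> 1" "\<And>y. \<bar>g y\<bar> \<le> 1"
  shows "measure_pmf.expectation (pair_pmf p q) (\<lambda>s. f (fst s) * g (snd s))
       = measure_pmf.expectation p f * measure_pmf.expectation q g"
proof -
  have b: "\<bar>f (fst s) * g (snd s)\<bar> \<le> 1" for s
    using mult_mono[of "\<bar>f (fst s)\<bar>" 1 "\<bar>g (snd s)\<bar>" 1] assms by (simp add: abs_mult)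
  show ?thesis
    unfolding pair_pmf_def
    by (subst expectation_bind_pmf[OF b], subst expectation_bind_pmf[OF b]) simp
qed

lemma integrable_pmf_bounded:
  fixes f :: "'a \<Rightarrow> real"
  assumes "\<And>x. \<bar>f x\<bar> \<le> B"
  shows "integrable (measure_pmf p) f"
  using assms by (intro measure_pmf.integrable_const_bound[where B = B]) auto

section \<open>The coalescing flow on a time grid\<close>

text \<open>
  Joint positions of the particles in \<open>F\<close>. The value outside \<open>F\<close> is fixed to \<open>0\<close>, the default
  value chosen for \<^const>\<open>Pi_pmf\<close> throughout, so that equality of such functions means agreement on \<open>F\<close>.
\<close>

definition restr :: "'a set \<Rightarrow> ('a \<Rightarrow> int) \<Rightarrow> 'a \<Rightarrow> int" where
  "restr F f = (\<lambda>b. if b \<in> F then f b else 0)"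

lemma restr_restr [simp]: "restr F (restr G f) = restr (F \<inter> G) f"
  by (auto simp: restr_def)

lemma restr_cong: "(\<And>b. b \<in> F \<Longrightarrow> f b = g b) \<Longrightarrow> restr F f = restr F g"
  by (auto simp: restr_def)

text \<open>
  One time step of the coalescing particles in \<open>F\<close> at positions \<open>y\<close>: each occupied site draws one arrow
  with law \<open>p\<close>, independently of the other sites, and all particles at the site move along it.
  Particles that share a site therefore stay together.
\<close>

definition coalescing_step :: "(int \<Rightarrow> int pmf) \<Rightarrow> 'a set \<Rightarrow> ('a \<Rightarrow> int) \<Rightarrow> ('a \<Rightarrow> int) pmf" where
  "coalescing_step p F y = map_pmf (\<lambda>U. restr F (\<lambda>b. U (y b))) (Pi_pmf (y ` F) 0 p)"

primrec coalescing_flow :: "(int \<Rightarrow> int pmf) list \<Rightarrow> 'a set \<Rightarrow> ('a \<Rightarrow> int) \<Rightarrow> ('a \<Rightarrow> int) pmf" where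
  "coalescing_flow [] F y = return_pmf (restr F y)"
| "coalescing_flow (p # ps) F y = bind_pmf (coalescing_step p F y) (coalescing_flow ps F)"

lemma coalescing_step_cong:
  "(\<And>b. b \<in> F \<Longrightarrow> y b = y' b) \<Longrightarrow> coalescing_step p F y = coalescing_step p F y'"
  unfolding coalescing_step_def by (auto simp: restr_def cong: image_cong intro!: map_pmf_cong)

lemma coalescing_flow_cong:
  "(\<And>b. b \<in> F \<Longrightarrow> y b = y' b) \<Longrightarrow> coalescing_flow ps F y = coalescing_flow ps F y'"
  by (cases ps) (auto simp: coalescing_step_cong[of F y y'] cong: restr_cong)

lemma coalescing_step_restr:
  assumes "finite F" "G \<subseteq> F"
  shows "map_pmf (restr G) (coalescing_step p F y) = coalescing_step p G y"
proof -
  have "y ` G \<subseteq> y ` F"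
    using assms by auto
  then have "Pi_pmf (y ` G) 0 p = map_pmf (\<lambda>f x. if x \<in> y ` G then f x else 0) (Pi_pmf (y ` F) 0 p)"
    using assms by (intro Pi_pmf_subset) auto
  then show ?thesis
    using assms(2) unfolding coalescing_step_def
    by (auto simp: map_pmf_comp restr_def intro!: map_pmf_cong ext)
qed

text \<open>
  Consistency: as the randomness sits at the sites and not at the particles, dropping particles does
  not change the law of the others.
\<close>

lemma coalescing_flow_restr:
  assumes "finite F" "G \<subseteq> F"
  shows "map_pmf (restr G) (coalescing_flow ps F y) = coalescing_flow ps G y"
proof (induction ps arbitrary: y)
  case Nil
  show ?case
    using assms by (simp add: Int_absorb2)
next
  case (Cons p ps)
  have "coalescing_flow ps G y = coalescing_flow ps G (restr G y)" for y
    by (rule coalescing_flow_cong) (simp add: restr_def)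
  then have "map_pmf (restr G) (coalescing_flow (p # ps) F y)
      = bind_pmf (coalescing_step p F y) (\<lambda>z. coalescing_flow ps G (restr G z))"
    by (simp add: map_bind_pmf Cons)
  also have "\<dots> = bind_pmf (map_pmf (restr G) (coalescing_step p F y)) (coalescing_flow ps G)"
    by (simp add: bind_map_pmf)
  finally show ?case
    by (simp add: coalescing_step_restr[OF assms])
qed

text \<open>
  Two groups that occupy disjoint sets of sites use disjoint sets of arrows.
\<close>

lemma coalescing_step_disjoint:
  assumes "finite F" "finite G" "y ` F \<inter> y ` G = {}"
  shows "map_pmf (\<lambda>z. (restr F z, restr G z)) (coalescing_step p (F \<union> G) y)
       = pair_pmf (coalescing_step p F y) (coalescing_step p G y)"
proof -
  have "map_pmf (\<lambda>z. (restr F z, restr G z)) (coalescing_step p (F \<union> G) y)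
      = map_pmf (\<lambda>U. (restr F (\<lambda>b. U (y b)), restr G (\<lambda>b. U (y b)))) (Pi_pmf (y ` F \<union> y ` G) 0 p)"
    unfolding coalescing_step_def by (simp add: map_pmf_comp image_Un Int_absorb2)
  also have "\<dots> = map_pmf (\<lambda>s. (restr F (\<lambda>b. fst s (y b)), restr G (\<lambda>b. snd s (y b))))
      (pair_pmf (Pi_pmf (y ` F) 0 p) (Pi_pmf (y ` G) 0 p))"
  proof -
    have not_in: "y b \<notin> y ` F" if "b \<in> G" for b
      using assms(3) that by auto
    show ?thesis
      using assms by (subst Pi_pmf_union)
        (auto simp: map_pmf_comp case_prod_beta restr_def not_in intro!: map_pmf_cong ext)
  qed
  also have "\<dots> = pair_pmf (coalescing_step p F y) (coalescing_step p G y)"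
    unfolding coalescing_step_def map_pair[symmetric] by (simp add: split_def)
  finally show ?thesis .
qed

lemma coalescing_step_marginal:
  assumes "finite F" "a \<in> F"
  shows "map_pmf (\<lambda>z. z a) (coalescing_step p F y) = p (y a)"
  using assms unfolding coalescing_step_def
  by (simp add: map_pmf_comp restr_def Pi_pmf_component)

section \<open>Meeting, reflection and decoupling\<close>

text \<open>
  The probability that independent chains from \<open>x\<close> and \<open>y\<close> with the given steps are at the same
  position at some time, the initial and the final time included.
\<close>

primrec meeting_prob :: "(int \<Rightarrow> int pmf) list \<Rightarrow> int \<Rightarrow> int \<Rightarrow> real" where
  "meeting_prob [] x y = (if x = y then 1 else 0)"
| "meeting_prob (p # ps) x y = (if x = y then 1 else
     measure_pmf.expectation (pair_pmf (p x) (p y)) (\<lambda>s. meeting_prob ps (fst s) (snd s)))"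

lemma meeting_prob_bounds: "0 \<le> meeting_prob ps x y \<and> meeting_prob ps x y \<le> 1"
proof (induction ps arbitrary: x y)
  case (Cons p ps)
  show ?case
    using Cons by (auto intro!: integral_nonneg_AE measure_pmf.integral_le_const
        integrable_pmf_bounded[where B = 1])
qed auto

lemma meeting_prob_abs: "\<bar>meeting_prob ps x y\<bar> \<le> 1"
  using meeting_prob_bounds[of ps x y] by simp

primrec markov_chain :: "(int \<Rightarrow> int pmf) list \<Rightarrow> int \<Rightarrow> int pmf" where
  "markov_chain [] x = return_pmf x"
| "markov_chain (p # ps) x = bind_pmf (p x) (markov_chain ps)"

lemma pair_bind_pmf:
  "pair_pmf (bind_pmf p f) (bind_pmf q g)
   = bind_pmf (pair_pmf p q) (\<lambda>s. pair_pmf (f (fst s)) (g (snd s)))"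
  unfolding pair_pmf_def bind_assoc_pmf bind_return_pmf fst_conv snd_conv
  by (subst bind_commute_pmf[of q]) simp

text \<open>
  Reflection principle. From the moment they meet, both chains have the same law, so by symmetry the
  first ends weakly above the second with probability at least \<open>1/2\<close>. The induction on the steps
  performs the conditioning on the first meeting: it stops at \<open>x = y\<close>, where the symmetry argument
  applies, and otherwise averages over the next positions.
\<close>

lemma meeting_prob_reflection:
  "meeting_prob ps x y
     \<le> 2 * measure_pmf.prob (pair_pmf (markov_chain ps x) (markov_chain ps y)) {s. fst s \<ge> snd s}"
proof (induction ps arbitrary: x y)
  case (Cons p ps)
  let ?G = "\<lambda>ps x y. measure_pmf.prob (pair_pmf (markov_chain ps x) (markov_chain ps y)) {s. fst s \<ge> snd s}"
  show ?case
  proof (cases "x = y")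
    case True
    let ?q = "markov_chain (p # ps) x"
    have "measure_pmf.prob (pair_pmf ?q ?q) {s. snd s \<ge> fst s}
        = measure_pmf.prob (pair_pmf ?q ?q) {s. fst s \<ge> snd s}"
      by (subst pair_commute_pmf) (simp add: vimage_def case_prod_beta del: markov_chain.simps)
    moreover have "1 \<le> measure_pmf.prob (pair_pmf ?q ?q) {s. fst s \<ge> snd s}
        + measure_pmf.prob (pair_pmf ?q ?q) {s. snd s \<ge> fst s}"
    proof -
      have "{s. fst s \<ge> snd s} \<union> {s. snd s \<ge> fst s} = (UNIV :: (int \<times> int) set)"
        by auto
      then show ?thesis
        using measure_Un_le[of "{s. fst s \<ge> snd s}" "measure_pmf (pair_pmf ?q ?q)" "{s. snd s \<ge> fst s}"]
        by (simp del: markov_chain.simps)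
    qed
    ultimately have "1 \<le> 2 * ?G (p # ps) x x"
      by linarith
    then show ?thesis
      using True by (simp del: markov_chain.simps)
  next
    case False
    have "meeting_prob (p # ps) x y
        \<le> measure_pmf.expectation (pair_pmf (p x) (p y)) (\<lambda>s. 2 * ?G ps (fst s) (snd s))"
      unfolding meeting_prob.simps if_not_P[OF False]
    proof (rule integral_mono)
      show "integrable (pair_pmf (p x) (p y)) (\<lambda>s. meeting_prob ps (fst s) (snd s))"
        by (rule integrable_pmf_bounded[OF meeting_prob_abs])
      show "integrable (pair_pmf (p x) (p y)) (\<lambda>s. 2 * ?G ps (fst s) (snd s))"
        by (rule integrable_pmf_bounded[where B = 2]) auto
    qed (rule Cons)
    also have "\<dots> = 2 * ?G (p # ps) x y"
      by (simp add: pair_bind_pmf prob_bind_pmf)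
    finally show ?thesis .
  qed
qed auto

text \<open>
  Two groups of particles are independent until some particle of one group meets some particle of the
  other, and up to then the two particles that meet perform independent chains. The induction makes
  this precise: while the groups occupy disjoint sites, the next positions of \<open>F\<close> and \<open>G\<close> are
  independent and so are those of any two particles \<open>a\<close> and \<open>b\<close>; as soon as they share a site, the right-hand
  side is at least \<open>1\<close>.
\<close>

lemma coalescing_flow_decoupling:
  assumes F: "finite F" "finite G"
  shows "\<bar>measure_pmf.prob (coalescing_flow ps (F \<union> G) y) {z. restr F z \<in> A \<and> restr G z \<in> B}
        - measure_pmf.prob (coalescing_flow ps F y) A * measure_pmf.prob (coalescing_flow ps G y) B\<bar>
      \<le> (\<Sum>a\<in>F. \<Sum>b\<in>G. meeting_prob ps (y a) (y b))"
proof (induction ps arbitrary: y)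
  case Nil
  have "0 \<le> (\<Sum>a\<in>F. \<Sum>b\<in>G. meeting_prob [] (y a) (y b))"
    by (intro sum_nonneg) auto
  then show ?case
    by (simp add: indicator_def Int_absorb2 del: meeting_prob.simps)
next
  case (Cons p ps)
  let ?J = "{z. restr F z \<in> A \<and> restr G z \<in> B}"
  let ?P = "\<lambda>ps H y C. measure_pmf.prob (coalescing_flow ps H y) C"
  let ?E = "measure_pmf.expectation (coalescing_step p (F \<union> G) y)"
  show ?case
  proof (cases "y ` F \<inter> y ` G = {}")
    case False
    then obtain a b where ab: "a \<in> F" "b \<in> G" "y a = y b"
      by auto
    have "\<bar>?P (p # ps) (F \<union> G) y ?J - ?P (p # ps) F y A * ?P (p # ps) G y B\<bar> \<le> 1"
    proof -
      have "0 \<le> ?P (p # ps) F y A * ?P (p # ps) G y B" "?P (p # ps) F y A * ?P (p # ps) G y B \<le> 1"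
        using mult_mono[of "?P (p # ps) F y A" 1 "?P (p # ps) G y B" 1] by auto
      moreover have "0 \<le> ?P (p # ps) (F \<union> G) y ?J" "?P (p # ps) (F \<union> G) y ?J \<le> 1"
        by auto
      ultimately show ?thesis
        by linarith
    qed
    also have "1 = meeting_prob (p # ps) (y a) (y b)"
      using ab by simp
    also have "\<dots> \<le> (\<Sum>b\<in>G. meeting_prob (p # ps) (y a) (y b))"
      using ab F meeting_prob_bounds by (intro member_le_sum) auto
    also have "\<dots> \<le> (\<Sum>a\<in>F. \<Sum>b\<in>G. meeting_prob (p # ps) (y a) (y b))"
      using ab F meeting_prob_bounds
      by (intro member_le_sum[where f = "\<lambda>a. \<Sum>b\<in>G. meeting_prob (p # ps) (y a) (y b)"] sum_nonneg) auto
    finally show ?thesis .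
  next
    case True
    have pair: "map_pmf (\<lambda>z. (restr F z, restr G z)) (coalescing_step p (F \<union> G) y)
        = pair_pmf (coalescing_step p F y) (coalescing_step p G y)"
      by (rule coalescing_step_disjoint[OF F True])
    have cong: "?P ps H (restr H z) C = ?P ps H z C" for H z C
      by (subst coalescing_flow_cong[of H "restr H z" z]) (auto simp: restr_def)
    have "?P (p # ps) F y A * ?P (p # ps) G y B = measure_pmf.expectation
        (pair_pmf (coalescing_step p F y) (coalescing_step p G y)) (\<lambda>s. ?P ps F (fst s) A * ?P ps G (snd s) B)"
      by (subst expectation_pair_pmf_mult) (auto simp: prob_bind_pmf)
    also have "\<dots> = ?E (\<lambda>z. ?P ps F z A * ?P ps G z B)"
      unfolding pair[symmetric] by (simp add: cong)
    finally have prod: "?P (p # ps) F y A * ?P (p # ps) G y B = ?E (\<lambda>z. ?P ps F z A * ?P ps G z B)" .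
    have bound: "\<bar>?P ps F z A * ?P ps G z B\<bar> \<le> 1" for z
      using mult_mono[of "?P ps F z A" 1 "?P ps G z B" 1] by (simp add: abs_mult)
    have "?P (p # ps) (F \<union> G) y ?J - ?P (p # ps) F y A * ?P (p # ps) G y B
        = ?E (\<lambda>z. ?P ps (F \<union> G) z ?J - ?P ps F z A * ?P ps G z B)"
      unfolding prod by (subst Bochner_Integration.integral_diff)
        (auto simp: prob_bind_pmf intro!: integrable_pmf_bounded[where B = 1] bound)
    also have "\<bar>\<dots>\<bar> \<le> ?E (\<lambda>z. \<bar>?P ps (F \<union> G) z ?J - ?P ps F z A * ?P ps G z B\<bar>)"
      by (rule integral_abs_bound)
    also have "\<dots> \<le> ?E (\<lambda>z. \<Sum>a\<in>F. \<Sum>b\<in>G. meeting_prob ps (z a) (z b))"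
    proof (rule integral_mono)
      have "\<bar>?P ps (F \<union> G) z ?J - ?P ps F z A * ?P ps G z B\<bar> \<le> 2" for z
        using bound[of z] measure_pmf.prob_le_1[of "coalescing_flow ps (F \<union> G) z" ?J]
          measure_nonneg[of "coalescing_flow ps (F \<union> G) z" ?J] by linarith
      then show "integrable (coalescing_step p (F \<union> G) y)
          (\<lambda>z. \<bar>?P ps (F \<union> G) z ?J - ?P ps F z A * ?P ps G z B\<bar>)"
        by (intro integrable_pmf_bounded[where B = 2]) auto
      show "integrable (coalescing_step p (F \<union> G) y) (\<lambda>z. \<Sum>a\<in>F. \<Sum>b\<in>G. meeting_prob ps (z a) (z b))"
        by (intro Bochner_Integration.integrable_sum) (rule integrable_pmf_bounded[OF meeting_prob_abs])
    qed (rule Cons)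
    also have "\<dots> = (\<Sum>a\<in>F. \<Sum>b\<in>G. ?E (\<lambda>z. meeting_prob ps (z a) (z b)))"
      by (simp add: Bochner_Integration.integral_sum Bochner_Integration.integrable_sum
          integrable_pmf_bounded[OF meeting_prob_abs])
    also have "\<dots> = (\<Sum>a\<in>F. \<Sum>b\<in>G. meeting_prob (p # ps) (y a) (y b))"
    proof (intro sum.cong refl)
      fix a b assume ab: "a \<in> F" "b \<in> G"
      then have "y a \<noteq> y b"
        using True by auto
      have "map_pmf (\<lambda>z. (z a, z b)) (coalescing_step p (F \<union> G) y)
          = map_pmf (\<lambda>s. (fst s a, snd s b)) (map_pmf (\<lambda>z. (restr F z, restr G z)) (coalescing_step p (F \<union> G) y))"
        using ab by (simp add: map_pmf_comp restr_def)
      also have "\<dots> = pair_pmf (p (y a)) (p (y b))"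
        unfolding pair using ab F
        by (simp add: map_pair[symmetric] split_def
            flip: coalescing_step_marginal[of F a p y] coalescing_step_marginal[of G b p y])
      finally have "pair_pmf (p (y a)) (p (y b)) = map_pmf (\<lambda>z. (z a, z b)) (coalescing_step p (F \<union> G) y)"
        by simp
      then show "?E (\<lambda>z. meeting_prob ps (z a) (z b)) = meeting_prob (p # ps) (y a) (y b)"
        using \<open>y a \<noteq> y b\<close> by simp
    qed
    finally show ?thesis .
  qed
qed

section \<open>Coalescence by following leaders\<close>

text \<open>
  Equal positions mean that the particles have merged. A cluster is led by its particle of smallest rank,
  the only one that still follows its own free path.
\<close>

definition leader :: "('a \<Rightarrow> nat) \<Rightarrow> 'a set \<Rightarrow> ('a \<Rightarrow> int) \<Rightarrow> 'a \<Rightarrow> 'a" where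
  "leader r F y b = arg_min r (\<lambda>c. c \<in> F \<and> y c = y b)"

lemma leader:
  assumes "b \<in> F"
  shows leader_in: "leader r F y b \<in> F" and leader_value: "y (leader r F y b) = y b"
    and leader_le: "\<And>c. c \<in> F \<Longrightarrow> y c = y b \<Longrightarrow> r (leader r F y b) \<le> r c"
  using arg_min_natI[of "\<lambda>c. c \<in> F \<and> y c = y b" b r] arg_min_nat_le[of "\<lambda>c. c \<in> F \<and> y c = y b" _ r] assms
  unfolding leader_def by auto

lemma leader_cong: "y b = y c \<Longrightarrow> leader r F y b = leader r F y c"
  by (simp add: leader_def)

text \<open>
  The coalescing positions after one more time step, from the coalescing positions \<open>y\<close> before it and the
  free positions \<open>x'\<close> after it: everybody is where its leader's free path is. Ties created by this
  step take effect only through the leaders of the next step.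
\<close>

definition follow_leaders :: "('a \<Rightarrow> nat) \<Rightarrow> 'a set \<Rightarrow> ('a \<Rightarrow> int) \<Rightarrow> ('a \<Rightarrow> int) \<Rightarrow> 'a \<Rightarrow> int" where
  "follow_leaders r F y x' = restr F (\<lambda>b. x' (leader r F y b))"

text \<open>
  The leaders move freely: after the step, too, each particle sits on the free path of its new leader.
  The new leader \<open>c\<close> of \<open>b\<close> already was its own leader, since its old leader has moved to the same site and
  has no larger rank.
\<close>

lemma follow_leaders_invariant:
  assumes "inj r" "b \<in> F"
  shows "follow_leaders r F y x' b = x' (leader r F (follow_leaders r F y x') b)"
proof -
  let ?y' = "follow_leaders r F y x'"
  define c where "c = leader r F ?y' b"
  have c: "c \<in> F" "?y' c = ?y' b" "\<And>d. d \<in> F \<Longrightarrow> ?y' d = ?y' b \<Longrightarrow> r c \<le> r d"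
    using leader[OF assms(2), where r = r and y = ?y'] by (auto simp: c_def)
  define d where "d = leader r F y c"
  have d: "d \<in> F" "y d = y c" "r d \<le> r c"
    using leader[OF c(1), where r = r and y = y] c(1) by (auto simp: d_def)
  have "?y' d = ?y' c"
    using leader_cong[of y d c r F] d c(1) by (simp add: follow_leaders_def restr_def)
  then have "r c \<le> r d"
    using c(2,3) d(1) by simp
  then have "d = c"
    using d(3) assms(1) by (simp add: inj_eq)
  then have "?y' c = x' c"
    using c(1) by (simp add: follow_leaders_def restr_def flip: d_def)
  then show ?thesis
    using c(2) by (simp add: c_def)
qed

text \<open>
  Independent draws with laws \<open>q (h a)\<close>, indexed by \<open>a\<close>, are the same as independent draws indexed by the
  distinct points \<open>h a\<close>.
\<close>

lemma Pi_pmf_reindex: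
  assumes "finite A" "inj_on h A"
  shows "Pi_pmf A d (\<lambda>a. q (h a)) = map_pmf (\<lambda>f a. if a \<in> A then f (h a) else d) (Pi_pmf (h ` A) d q)"
  using assms
proof (induction rule: finite_induct)
  case (insert x A)
  have hx: "h x \<notin> h ` A" and inj: "inj_on h A"
    using insert.prems insert.hyps by auto
  have ne: "h a \<noteq> h x" if "a \<in> A" for a
    using hx that by (metis imageI)
  have "Pi_pmf (insert x A) d (\<lambda>a. q (h a))
      = map_pmf (\<lambda>s. (snd s)(x := fst s)) (pair_pmf (q (h x)) (Pi_pmf A d (\<lambda>a. q (h a))))"
    using insert.hyps by (simp add: Pi_pmf_insert split_def)
  also have "\<dots> = map_pmf (\<lambda>s. (\<lambda>a. if a \<in> A then snd s (h a) else d)(x := fst s))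
      (pair_pmf (q (h x)) (Pi_pmf (h ` A) d q))"
    unfolding insert.IH[OF inj] pair_map_pmf2 by (simp add: map_pmf_comp apsnd_def map_prod_def split_def)
  also have "\<dots> = map_pmf (\<lambda>f a. if a \<in> insert x A then f (h a) else d)
      (map_pmf (\<lambda>s. (snd s)(h x := fst s)) (pair_pmf (q (h x)) (Pi_pmf (h ` A) d q)))"
    using insert.hyps(2) ne by (auto simp: map_pmf_comp intro!: map_pmf_cong ext)
  also have "\<dots> = map_pmf (\<lambda>f a. if a \<in> insert x A then f (h a) else d) (Pi_pmf (h ` insert x A) d q)"
    using insert.hyps hx by (simp add: Pi_pmf_insert split_def)
  finally show ?case .
qed auto

text \<open>
  The particles of a cluster follow one free path, that of their leader, and the leaders are at distinct
  sites. So the steps of the leaders can serve as the arrows at the occupied sites, whatever the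
  ranking is.
\<close>

lemma follow_leaders_law:
  assumes "finite F" and y: "\<And>b. b \<in> F \<Longrightarrow> y b = x (leader r F y b)"
  shows "map_pmf (follow_leaders r F y) (Pi_pmf F 0 (\<lambda>b. p (x b))) = coalescing_step p F y"
proof -
  define L where "L = leader r F y ` F"
  have LF: "L \<subseteq> F" "finite L"
    using assms(1) leader_in by (auto simp: L_def)
  have xy: "y c = x c" if c: "c \<in> L" for c
  proof -
    obtain b where "b \<in> F" "c = leader r F y b"
      using c by (auto simp: L_def)
    then show ?thesis
      using y[of b] leader_value[of b F y r] by simp
  qed
  have inj: "inj_on y L"
  proof (rule inj_onI)
    fix c d assume cd: "c \<in> L" "d \<in> L" "y c = y d"
    obtain a b where ab: "a \<in> F" "c = leader r F y a" "b \<in> F" "d = leader r F y b"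
      using cd by (auto simp: L_def)
    then have "y a = y b"
      using cd(3) by (simp add: leader_value)
    then show "c = d"
      using ab by (simp add: leader_cong[of y a b])
  qed
  have img: "y ` L = y ` F"
    unfolding L_def image_image by (auto simp: leader_value intro!: image_cong)
  \<comment> \<open>Only the free steps of the current leaders are used.\<close>
  have dep: "follow_leaders r F y x' = follow_leaders r F y (\<lambda>c. if c \<in> L then x' c else 0)" for x'
    unfolding follow_leaders_def by (rule restr_cong) (simp add: L_def)
  have "map_pmf (follow_leaders r F y) (Pi_pmf F 0 (\<lambda>b. p (x b)))
      = map_pmf (follow_leaders r F y) (map_pmf (\<lambda>x' c. if c \<in> L then x' c else 0) (Pi_pmf F 0 (\<lambda>b. p (x b))))"
    unfolding map_pmf_comp using dep by (intro map_pmf_cong) auto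
  also have "\<dots> = map_pmf (follow_leaders r F y) (Pi_pmf L 0 (\<lambda>b. p (x b)))"
    by (simp add: Pi_pmf_subset[OF assms(1) LF(1)])
  also have "Pi_pmf L 0 (\<lambda>b. p (x b)) = Pi_pmf L 0 (\<lambda>b. p (y b))"
    using LF xy by (intro Pi_pmf_cong) auto
  also have "\<dots> = map_pmf (\<lambda>f c. if c \<in> L then f (y c) else 0) (Pi_pmf (y ` F) 0 p)"
    by (simp add: Pi_pmf_reindex[OF LF(2) inj] img)
  also have "map_pmf (follow_leaders r F y) \<dots> = coalescing_step p F y"
    unfolding coalescing_step_def map_pmf_comp follow_leaders_def
    by (intro map_pmf_cong refl restr_cong) (simp add: L_def leader_value)
  finally show ?thesis .
qed

section \<open>Free chains and their law\<close>

text \<open>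
  The positions of independent particles after each step, the initial position \<open>x\<close> excluded.
\<close>

primrec free_chain :: "(int \<Rightarrow> int pmf) list \<Rightarrow> 'a set \<Rightarrow> ('a \<Rightarrow> int) \<Rightarrow> ('a \<Rightarrow> int) list pmf" where
  "free_chain [] F x = return_pmf []"
| "free_chain (p # ps) F x =
     bind_pmf (Pi_pmf F 0 (\<lambda>b. p (x b))) (\<lambda>x'. map_pmf ((#) x') (free_chain ps F x'))"

text \<open>
  Merging independent free paths by rank yields the coalescing flow. In particular the law of the merged
  positions does not depend on the ranking.
\<close>

lemma follow_leaders_chain_law:
  assumes "finite F" "inj r" "restr F y = y" "\<And>b. b \<in> F \<Longrightarrow> y b = x (leader r F y b)"
  shows "map_pmf (foldl (follow_leaders r F) y) (free_chain ps F x) = coalescing_flow ps F y"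
  using assms(3,4)
proof (induction ps arbitrary: x y)
  case (Cons p ps)
  have "map_pmf (foldl (follow_leaders r F) y) (free_chain (p # ps) F x)
      = bind_pmf (Pi_pmf F 0 (\<lambda>b. p (x b)))
          (\<lambda>x'. map_pmf (foldl (follow_leaders r F) (follow_leaders r F y x')) (free_chain ps F x'))"
    by (simp add: map_bind_pmf map_pmf_comp)
  also have "\<dots> = bind_pmf (Pi_pmf F 0 (\<lambda>b. p (x b))) (\<lambda>x'. coalescing_flow ps F (follow_leaders r F y x'))"
  proof (rule bind_pmf_cong[OF refl])
    fix x'
    show "map_pmf (foldl (follow_leaders r F) (follow_leaders r F y x')) (free_chain ps F x')
        = coalescing_flow ps F (follow_leaders r F y x')"
      by (rule Cons.IH) (simp add: follow_leaders_def, rule follow_leaders_invariant[OF assms(2)])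
  qed
  also have "\<dots> = bind_pmf (map_pmf (follow_leaders r F y) (Pi_pmf F 0 (\<lambda>b. p (x b)))) (coalescing_flow ps F)"
    by (simp add: bind_map_pmf)
  also have "\<dots> = coalescing_flow (p # ps) F y"
    by (simp add: follow_leaders_law[where p = p and x = x and y = y and r = r, OF assms(1) Cons.prems(2)])
  finally show ?case .
qed auto

lemma pmf_free_chain_Cons:
  "pmf (free_chain (p # ps) F x) (x' # xs) = pmf (Pi_pmf F 0 (\<lambda>b. p (x b))) x' * pmf (free_chain ps F x') xs"
proof -
  have eq: "pmf (map_pmf ((#) z) (free_chain ps F z)) (x' # xs) = indicator {x'} z * pmf (free_chain ps F x') xs" for z
  proof (cases "z = x'")
    case True
    then show ?thesis
      by (simp add: pmf_map_inj')
  next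
    case False
    then have "x' # xs \<notin> set_pmf (map_pmf ((#) z) (free_chain ps F z))"
      by auto
    then have "pmf (map_pmf ((#) z) (free_chain ps F z)) (x' # xs) = 0"
      by (rule pmf_eq_0_set_pmf[THEN iffD2])
    with False show ?thesis
      by simp
  qed
  show ?thesis
    by (simp add: pmf_bind eq measure_pmf_single)
qed

lemma pmf_free_chain:
  assumes "j \<le> n"
  shows "pmf (free_chain (map p [j..<n]) F (\<xi> j)) (map \<xi> [Suc j..<Suc n])
       = (\<Prod>i=j..<n. pmf (Pi_pmf F 0 (\<lambda>b. p i (\<xi> i b))) (\<xi> (Suc i)))"
  using assms
proof (induction "n - j" arbitrary: j)
  case (Suc d)
  then have "[j..<n] = j # [Suc j..<n]" "[Suc j..<Suc n] = Suc j # [Suc (Suc j)..<Suc n]"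
    "{j..<n} = insert j {Suc j..<n}"
    by (auto simp: upt_conv_Cons)
  then show ?case
    using Suc.hyps(1)[of "Suc j"] Suc.hyps(2) Suc.prems
    by (simp add: pmf_free_chain_Cons del: free_chain.simps upt_Suc)
qed auto

lemma set_free_chain:
  assumes "finite F" "xs \<in> set_pmf (free_chain ps F x)"
  shows "length xs = length ps \<and> (\<forall>x'\<in>set xs. restr F x' = x')"
  using assms(2)
proof (induction ps arbitrary: x xs)
  case (Cons p ps)
  then obtain x' ys where ys: "x' \<in> set_pmf (Pi_pmf F 0 (\<lambda>b. p (x b)))" "ys \<in> set_pmf (free_chain ps F x')" "xs = x' # ys"
    by auto
  then have "restr F x' = x'"
    using set_Pi_pmf_subset[OF assms(1)] by (fastforce simp: restr_def)
  with ys Cons.IH[OF ys(2)] show ?case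
    by auto
qed auto

text \<open>
  If \<open>L\<close> gives each atom \<open>l\<close> of \<open>Q\<close> the right probability, then \<open>L\<close> has law \<open>Q\<close>. The set of values of \<open>L\<close> may
  be uncountable, and \<open>L \<in> A\<close> need not be measurable; the event \<open>E\<close> replaces it up to a null set.
\<close>

lemma (in prob_space) pmf_event:
  assumes point: "\<And>l. l \<in> set_pmf Q \<Longrightarrow> {\<omega> \<in> space M. L \<omega> = l} \<in> events \<and> prob {\<omega> \<in> space M. L \<omega> = l} = pmf Q l"
  obtains E where "E \<in> events" "AE \<omega> in M. \<omega> \<in> E \<longleftrightarrow> L \<omega> \<in> A" "prob E = measure_pmf.prob Q A"
proof -
  \<comment> \<open>\<open>L \<in> C\<close>, restricted to the countably many atoms of \<open>Q\<close>.\<close>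
  define D where "D = (\<lambda>C. \<Union>l\<in>C \<inter> set_pmf Q. {\<omega> \<in> space M. L \<omega> = l})"
  have D: "D C \<in> events" "prob (D C) = measure_pmf.prob Q C" for C
  proof -
    have count: "countable (C \<inter> set_pmf Q)"
      by (rule countable_Int2) simp
    then show "D C \<in> events"
      unfolding D_def using point by (intro sets.countable_UN'') auto
    have disj: "disjoint_family_on (\<lambda>l. {\<omega> \<in> space M. L \<omega> = l}) (C \<inter> set_pmf Q)"
      by (auto simp: disjoint_family_on_def)
    have "emeasure M (D C) = (\<integral>\<^sup>+ l. emeasure M {\<omega> \<in> space M. L \<omega> = l} \<partial>count_space (C \<inter> set_pmf Q))"
      unfolding D_def using point count disj by (intro emeasure_UN_countable) auto
    also have "\<dots> = (\<integral>\<^sup>+ l. pmf Q l \<partial>count_space (C \<inter> set_pmf Q))"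
      using point by (intro nn_integral_cong) (simp add: emeasure_eq_measure)
    also have "\<dots> = emeasure (measure_pmf Q) (C \<inter> set_pmf Q)"
      by (rule nn_integral_pmf)
    also have "\<dots> = emeasure (measure_pmf Q) C"
      by (rule emeasure_Int_set_pmf)
    finally show "prob (D C) = measure_pmf.prob Q C"
      by (simp add: measure_def)
  qed
  have "prob (D UNIV) = 1"
    by (simp add: D measure_pmf.prob_space)
  then have "AE \<omega> in M. \<omega> \<in> D UNIV"
    using D(1) prob_eq_1 by blast
  then have "AE \<omega> in M. \<omega> \<in> D A \<longleftrightarrow> L \<omega> \<in> A"
    by eventually_elim (auto simp: D_def)
  then show thesis
    using that D by blast
qed

section \<open>First meetings in a coalescing family of paths\<close>

text \<open>
  The time at which particle \<open>a\<close> stops following its own free path.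
\<close>

definition first_meeting :: "real set \<Rightarrow> (int \<Rightarrow> nat) \<Rightarrow> (int \<Rightarrow> real \<Rightarrow> int) \<Rightarrow> (int \<Rightarrow> real \<Rightarrow> int) \<Rightarrow> int \<Rightarrow> real \<Rightarrow> bool" where
  "first_meeting TT r x y a s \<longleftrightarrow> s \<in> TT \<and> (\<exists>b. r b < r a \<and> x a s = y b s) \<and>
     (\<forall>u\<in>TT. u < s \<longrightarrow> (\<forall>c. r c < r a \<longrightarrow> x a u \<noteq> y c u))"

text \<open>
  If \<open>a\<close> ever meets a particle of smaller rank, there is a first time of meeting. In continuous time this
  needs regularity of the paths, and without a first time the defining clauses of
  \<^const>\<open>coalescing_paths\<close> say nothing about \<open>y a\<close> afterwards.
\<close>

definition first_meetings_exist :: "real set \<Rightarrow> (int \<Rightarrow> nat) \<Rightarrow> (int \<Rightarrow> real \<Rightarrow> int) \<Rightarrow> (int \<Rightarrow> real \<Rightarrow> int) \<Rightarrow> int \<Rightarrow> bool" where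
  "first_meetings_exist TT r x y a \<longleftrightarrow>
     (\<forall>t\<in>TT. \<forall>b. r b < r a \<longrightarrow> x a t = y b t \<longrightarrow> (\<exists>s\<le>t. first_meeting TT r x y a s))"

lemma coalescing_paths_free:
  assumes "coalescing_paths TT r x y" "t \<in> TT"
    and "\<And>s. s \<le> t \<Longrightarrow> \<not> first_meeting TT r x y a s" and "first_meetings_exist TT r x y a"
  shows "y a t = x a t"
proof -
  have "x a s \<noteq> y b s" if s: "s \<in> TT" "s \<le> t" "r b < r a" for s b
  proof
    assume "x a s = y b s"
    then obtain u where "u \<le> s" "first_meeting TT r x y a u"
      using assms(4) s unfolding first_meetings_exist_def by auto
    then show False
      using assms(3)[of u] s(2) by simp
  qed
  then show ?thesis
    using assms(1)[unfolded coalescing_paths_def, THEN conjunct1, rule_format, OF assms(2)] by auto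
qed

lemma coalescing_paths_joined:
  assumes "coalescing_paths TT r x y" "first_meeting TT r x y a s"
  obtains b where "r b < r a" "x a s = y b s" "\<And>t. t \<in> TT \<Longrightarrow> s \<le> t \<Longrightarrow> y a t = y b t"
proof -
  obtain b where b: "r b < r a" "x a s = y b s"
    using assms(2) by (auto simp: first_meeting_def)
  moreover have "y a t = y b t" if "t \<in> TT" "s \<le> t" for t
    using assms(1)[unfolded coalescing_paths_def, THEN conjunct2, rule_format, OF _ b _ that] assms(2)
    by (auto simp: first_meeting_def)
  ultimately show thesis
    by (rule that)
qed

text \<open>
  Induction on the sum of the ranks. The particle \<open>b\<close> of larger rank must have met a particle \<open>b'\<close> of
  smaller rank by time \<open>s\<close>, since otherwise it would be on its free path and would meet \<open>c\<close> at time \<open>s\<close>; so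
  \<open>b\<close> can be replaced by \<open>b'\<close>.
\<close>

lemma coalescing_paths_stay_together:
  assumes cp: "coalescing_paths TT r x y" and fm: "\<And>a. first_meetings_exist TT r x y a"
    and "y b s = y c s" "s \<in> TT" "t \<in> TT" "s \<le> t" "inj r"
  shows "y b t = y c t"
  using assms(3)
proof (induction "r b + r c" arbitrary: b c rule: less_induct)
  case less
  have main: "y b t = y c t"
    if IH: "\<And>b' c'. r b' + r c' < r b + r c \<Longrightarrow> y b' s = y c' s \<Longrightarrow> y b' t = y c' t"
      and eq: "y b s = y c s" and lt: "r c < r b" for b c
  proof -
    have "\<exists>u\<le>s. first_meeting TT r x y b u"
    proof (rule ccontr)
      assume none: "\<not> ?thesis"
      then have "y b s = x b s"
        by (intro coalescing_paths_free[OF cp \<open>s \<in> TT\<close> _ fm]) auto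
      then have "\<exists>u\<le>s. first_meeting TT r x y b u"
        using fm[of b] eq lt \<open>s \<in> TT\<close> unfolding first_meetings_exist_def by simp
      with none show False ..
    qed
    then obtain u where u: "u \<le> s" "first_meeting TT r x y b u"
      by blast
    obtain b' where b': "r b' < r b" "\<And>t. t \<in> TT \<Longrightarrow> u \<le> t \<Longrightarrow> y b t = y b' t"
      using coalescing_paths_joined[OF cp u(2)] by blast
    have "y b' t = y c t"
      by (rule IH) (use b'(1) b'(2)[of s] u(1) eq assms(4) in auto)
    then show ?thesis
      using b'(2)[of t] u(1) assms(5,6) by simp
  qed
  consider "r c < r b" | "r b < r c" | "b = c"
    using injD[OF \<open>inj r\<close>, of b c] by linarith
  then show ?case
  proof cases
    case 1
    show ?thesis
      by (rule main[OF less.hyps less.prems 1])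
  next
    case 2
    have "y c t = y b t"
    proof (rule main[OF _ less.prems[symmetric] 2])
      fix b' c' assume "r b' + r c' < r c + r b" "y b' s = y c' s"
      then show "y b' t = y c' t"
        by (intro less.hyps) auto
    qed
    then show ?thesis
      by simp
  qed auto
qed

text \<open>
  The leader \<open>c\<close> of the cluster of \<open>b\<close> at time \<open>u\<close> has met nobody of smaller rank by then, for it would have
  merged with that particle. So \<open>c\<close> is still on its free path at time \<open>v\<close>, unless its first meeting
  falls between \<open>u\<close> and \<open>v\<close>; that case is covered by the assumption \<open>fine\<close>. The set \<open>F\<close> is closed under
  passing to smaller ranks, so that it contains all particles that influence its members.
\<close>

lemma coalescing_paths_follow_leader:
  assumes cp: "coalescing_paths TT r x y" and fm: "\<And>a. first_meetings_exist TT r x y a" and "inj r"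
    and uv: "u \<in> TT" "v \<in> TT" "u \<le> v"
    and F: "b \<in> F" "\<And>a c. a \<in> F \<Longrightarrow> r c < r a \<Longrightarrow> c \<in> F"
    and fine: "\<And>a s. a \<in> F \<Longrightarrow> first_meeting TT r x y a s \<Longrightarrow> u < s \<Longrightarrow> s \<le> v \<Longrightarrow> y a v = x a v"
  shows "y b v = x (leader r F (\<lambda>a. y a u) b) v"
proof -
  define c where "c = leader r F (\<lambda>a. y a u) b"
  have c: "c \<in> F" "y c u = y b u" "\<And>d. d \<in> F \<Longrightarrow> y d u = y b u \<Longrightarrow> r c \<le> r d"
    using leader[OF F(1), where r = r and y = "\<lambda>a. y a u"] by (auto simp: c_def)
  have "y b v = y c v"
    using coalescing_paths_stay_together[OF cp fm c(2) uv \<open>inj r\<close>] by simp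
  also have "y c v = x c v"
  proof (cases "\<exists>s\<le>v. first_meeting TT r x y c s")
    case False
    then show ?thesis
      by (intro coalescing_paths_free[OF cp uv(2) _ fm]) auto
  next
    case True
    then obtain s where s: "s \<le> v" "first_meeting TT r x y c s"
      by blast
    obtain d where d: "r d < r c" "\<And>t. t \<in> TT \<Longrightarrow> s \<le> t \<Longrightarrow> y c t = y d t"
      using coalescing_paths_joined[OF cp s(2)] by blast
    have "u < s"
    proof (rule ccontr)
      assume "\<not> u < s"
      then have "y d u = y b u"
        using d(2)[of u] uv c(2) by simp
      then show False
        using c(3)[of d] F(2)[OF c(1) d(1)] d(1) by simp
    qed
    then show ?thesis
      using fine c(1) s by blast
  qed
  finally show ?thesis
    by (simp add: c_def)
qed

section \<open>Resolving a coalescing family on a fine time grid\<close>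

text \<open>
  Right-continuity for the discrete topology of the integers.
\<close>

definition right_constant :: "(real \<Rightarrow> int) \<Rightarrow> bool" where
  "right_constant f \<longleftrightarrow> (\<forall>t\<ge>0. \<forall>\<^sub>F u in at_right t. f u = f t)"

lemma nearest_neighbour_right_constant:
  assumes "nearest_neighbour_path {0..} f"
  shows "right_constant f"
proof -
  have "(1 / 2 :: real) \<notin> \<nat>"
  proof
    assume "(1 / 2 :: real) \<in> \<nat>"
    then obtain n where "1 / 2 = real n"
      by (auto elim: Nats_cases)
    then have "real (2 * n) = real 1"
      by simp
    then have "2 * n = 1"
      by (rule of_nat_eq_iff[THEN iffD1])
    then show False
      by presburger
  qed
  moreover have "(1 / 2 :: real) \<in> {0..}"
    by simp
  ultimately have "{0 :: real..} \<noteq> \<nat>"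
    by metis
  then show ?thesis
    using assms unfolding nearest_neighbour_path_def right_constant_def
    by (auto simp: continuous_within tendsto_discrete)
qed

lemma first_meeting_unique:
  assumes "first_meeting TT r x y a s" "first_meeting TT r x y a t"
  shows "s = t"
  using assms unfolding first_meeting_def by (metis linorder_neqE)

lemma coalescing_paths_at_first_meeting:
  assumes "coalescing_paths TT r x y" "first_meeting TT r x y a s"
  shows "y a s = x a s"
proof -
  obtain b where "x a s = y b s" "\<And>t. t \<in> TT \<Longrightarrow> s \<le> t \<Longrightarrow> y a t = y b t"
    using coalescing_paths_joined[OF assms] by blast
  then show ?thesis
    using assms(2) by (simp add: first_meeting_def)
qed

lemma finite_lower_rank: "inj r \<Longrightarrow> finite {b. r b < (n :: nat)}"
  using finite_vimageI[of "{..<n}" r] by (simp add: vimage_def)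

text \<open>
  The infimum of the meeting times is a meeting time: only the finitely many particles of smaller rank
  matter, and a pair of right-constant paths that differs at some time differs for a while.
\<close>

lemma first_meeting_attained:
  assumes "inj r" "right_constant (x a)" "\<And>b. r b < r a \<Longrightarrow> right_constant (y b)"
  shows "first_meetings_exist {0..} r x y a"
  unfolding first_meetings_exist_def
proof (intro ballI allI impI)
  fix t b assume t: "t \<in> {0..}" "r b < r a" "x a t = y b t"
  define S where "S = {u. 0 \<le> u \<and> (\<exists>b. r b < r a \<and> x a u = y b u)}"
  define s where "s = Inf S"
  have S: "t \<in> S" "bdd_below S" "\<And>u. u \<in> S \<Longrightarrow> 0 \<le> u"
    using t by (auto simp: S_def intro: bdd_belowI[of _ 0])
  have s: "0 \<le> s" "s \<le> t" "\<And>u. u \<in> S \<Longrightarrow> s \<le> u"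
    unfolding s_def using S by (auto intro: cInf_lower cInf_greatest)
  have "s \<in> S"
  proof (rule ccontr)
    assume "s \<notin> S"
    have "\<forall>b\<in>{b. r b < r a}. \<forall>\<^sub>F u in at_right s. x a u \<noteq> y b u"
    proof
      fix b assume b: "b \<in> {b. r b < r a}"
      have "\<forall>\<^sub>F u in at_right s. x a u = x a s" "\<forall>\<^sub>F u in at_right s. y b u = y b s"
        using assms(2,3) b s(1) by (auto simp: right_constant_def)
      then show "\<forall>\<^sub>F u in at_right s. x a u \<noteq> y b u"
      proof eventually_elim
        case (elim u)
        have "x a s \<noteq> y b s"
          using \<open>s \<notin> S\<close> s(1) b by (auto simp: S_def)
        with elim show ?case
          by simp
      qed
    qed
    then have "\<forall>\<^sub>F u in at_right s. \<forall>b\<in>{b. r b < r a}. x a u \<noteq> y b u"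
      by (intro eventually_ball_finite finite_lower_rank assms(1))
    then obtain e where e: "e > s" "\<And>u b. s < u \<Longrightarrow> u < e \<Longrightarrow> r b < r a \<Longrightarrow> x a u \<noteq> y b u"
      by (auto simp: eventually_at_right_field)
    have "e \<le> u" if "u \<in> S" for u
      using that s(3)[OF that] \<open>s \<notin> S\<close> e(2)[of u] by (force simp: S_def not_less[symmetric])
    then have "e \<le> s"
      unfolding s_def using S(1) by (intro cInf_greatest) auto
    with e(1) show False
      by simp
  qed
  then have "first_meeting {0..} r x y a s"
    using s(3) by (fastforce simp: first_meeting_def S_def not_le[symmetric])
  then show "\<exists>s\<le>t. first_meeting {0..} r x y a s"
    using s(2) by blast
qed

text \<open>
  Induction on the rank, as \<open>y a\<close> consists of a piece of the free path \<open>x a\<close> and, from the first meeting on,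
  a piece of a path of smaller rank.
\<close>

lemma coalescing_paths_right_constant:
  assumes cp: "coalescing_paths {0..} r x y" and "inj r" and x: "\<And>a. right_constant (x a)"
  shows "right_constant (y a)"
proof (induction "r a" arbitrary: a rule: less_induct)
  case less
  have fm: "first_meetings_exist {0..} r x y a"
    using less by (intro first_meeting_attained assms) auto
  show ?case
    unfolding right_constant_def
  proof (intro allI impI)
    fix t :: real assume "0 \<le> t"
    have right: "\<forall>\<^sub>F u in at_right t. t < u"
      by (rule eventually_at_right_less)
    show "\<forall>\<^sub>F u in at_right t. y a u = y a t"
    proof (cases "\<exists>s\<le>t. first_meeting {0..} r x y a s")
      case True
      then obtain s where s: "s \<le> t" "first_meeting {0..} r x y a s"
        by blast
      obtain b where b: "r b < r a" "\<And>u. u \<in> {0..} \<Longrightarrow> s \<le> u \<Longrightarrow> y a u = y b u"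
        using coalescing_paths_joined[OF cp s(2)] by blast
      have "\<forall>\<^sub>F u in at_right t. y b u = y b t"
        using less[OF b(1)] \<open>0 \<le> t\<close> by (simp add: right_constant_def)
      with right show ?thesis
        by eventually_elim (use b(2) s(1) \<open>0 \<le> t\<close> in auto)
    next
      case False
      have later: "\<forall>\<^sub>F u in at_right t. \<forall>s\<le>u. \<not> first_meeting {0..} r x y a s"
      proof (cases "\<exists>s. first_meeting {0..} r x y a s")
        case True
        then obtain s where s: "first_meeting {0..} r x y a s"
          by blast
        then have "t < s"
          using False by (meson not_le)
        then have "\<forall>\<^sub>F u in at_right t. u < s"
          by (auto simp: eventually_at_right_field)
        then show ?thesis
          by eventually_elim (use first_meeting_unique[OF s] in force)
      qed auto
      have free: "y a u = x a u" if "u \<in> {0..}" "\<forall>s\<le>u. \<not> first_meeting {0..} r x y a s" for u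
        by (rule coalescing_paths_free[OF cp that(1) _ fm]) (use that(2) in auto)
      have yt: "y a t = x a t"
        using free[of t] False \<open>0 \<le> t\<close> by auto
      have "\<forall>\<^sub>F u in at_right t. x a u = x a t"
        using x \<open>0 \<le> t\<close> by (simp add: right_constant_def)
      with right later show ?thesis
        by eventually_elim (use free yt \<open>0 \<le> t\<close> in auto)
    qed
  qed
qed

text \<open>
  The condition on a grid interval that makes following leaders exact: if \<open>a\<close> has its first meeting inside,
  then at the right end its free path and its coalescing path have not separated yet.
\<close>

definition resolves :: "real set \<Rightarrow> (int \<Rightarrow> nat) \<Rightarrow> (int \<Rightarrow> real \<Rightarrow> int) \<Rightarrow> (int \<Rightarrow> real \<Rightarrow> int) \<Rightarrow> int \<Rightarrow> real \<Rightarrow> real \<Rightarrow> bool" where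
  "resolves TT r x y a u v \<longleftrightarrow> (\<forall>s. first_meeting TT r x y a s \<longrightarrow> u < s \<longrightarrow> s \<le> v \<longrightarrow> y a v = x a v)"

text \<open>
  For a while after the first meeting time \<open>s\<close>, both \<open>x a\<close> and \<open>y a\<close> keep their common value at \<open>s\<close>. A mesh
  smaller than this while puts the right end of the grid interval around \<open>s\<close> into it.
\<close>

lemma equidistant_grid_resolves:
  assumes cp: "coalescing_paths {0..} r x y" and "inj r" and x: "\<And>a. right_constant (x a)"
  shows "\<forall>\<^sub>F m in sequentially. \<forall>i<Suc m. resolves {0..} r x y a (real i * T / real (Suc m)) (real (Suc i) * T / real (Suc m))"
proof (cases "\<exists>s. first_meeting {0..} r x y a s")
  case False
  then show ?thesis
    by (auto simp: resolves_def)
next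
  case True
  then obtain s where s: "first_meeting {0..} r x y a s"
    by blast
  then have "0 \<le> s"
    by (simp add: first_meeting_def)
  have ys: "y a s = x a s"
    by (rule coalescing_paths_at_first_meeting[OF cp s])
  have "\<forall>\<^sub>F u in at_right s. x a u = x a s" "\<forall>\<^sub>F u in at_right s. y a u = y a s"
    using x coalescing_paths_right_constant[OF assms] \<open>0 \<le> s\<close> by (auto simp: right_constant_def)
  then have "\<forall>\<^sub>F u in at_right s. y a u = x a u"
    by eventually_elim (simp add: ys)
  then obtain e where e: "e > s" "\<And>u. s < u \<Longrightarrow> u < e \<Longrightarrow> y a u = x a u"
    by (auto simp: eventually_at_right_field)
  have "(\<lambda>m. T * inverse (real (Suc m))) \<longlonglongrightarrow> T * 0"
    by (intro tendsto_mult tendsto_const LIMSEQ_inverse_real_of_nat)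
  then have "\<forall>\<^sub>F m in sequentially. T * inverse (real (Suc m)) < e - s"
    using e(1) by (intro order_tendstoD) auto
  then show ?thesis
  proof eventually_elim
    case (elim m)
    show ?case
      unfolding resolves_def
    proof (intro allI impI)
      fix i s' assume i: "i < Suc m" and s': "first_meeting {0..} r x y a s'"
        "real i * T / real (Suc m) < s'" "s' \<le> real (Suc i) * T / real (Suc m)"
      have "s' = s"
        using first_meeting_unique[OF s'(1) s] .
      have "real (Suc i) * T / real (Suc m) = real i * T / real (Suc m) + T * inverse (real (Suc m))"
        by (simp add: divide_inverse algebra_simps)
      then have "real (Suc i) * T / real (Suc m) < e"
        using elim s'(2) \<open>s' = s\<close> by linarith
      then show "y a (real (Suc i) * T / real (Suc m)) = x a (real (Suc i) * T / real (Suc m))"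
        using e(2) s'(3) ys \<open>s' = s\<close> by (cases "s = real (Suc i) * T / real (Suc m)") auto
    qed
  qed
qed

lemma first_meeting_attained_discrete: "first_meetings_exist \<nat> r x y a"
  unfolding first_meetings_exist_def
proof (intro ballI allI impI)
  fix t :: real and b assume t: "t \<in> \<nat>" "r b < r a" "x a t = y b t"
  define met where "met = (\<lambda>n :: nat. \<exists>b. r b < r a \<and> x a (real n) = y b (real n))"
  obtain n where n: "t = real n"
    using t(1) by (auto elim: Nats_cases)
  then have "met n"
    using t by (auto simp: met_def)
  define k where "k = (LEAST k. met k)"
  have k: "met k" "k \<le> n" "\<And>j. j < k \<Longrightarrow> \<not> met j"
    unfolding k_def using \<open>met n\<close> by (auto intro: LeastI Least_le dest: not_less_Least)
  have "first_meeting \<nat> r x y a (real k)"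
    unfolding first_meeting_def
  proof (intro conjI ballI impI allI)
    show "\<exists>b. r b < r a \<and> x a (real k) = y b (real k)"
      using k(1) by (simp add: met_def)
  next
    fix u :: real and c assume "u \<in> \<nat>" "u < real k" "r c < r a"
    then show "x a u \<noteq> y c u"
      using k(3) by (auto simp: met_def elim!: Nats_cases)
  qed auto
  then show "\<exists>s\<le>t. first_meeting \<nat> r x y a s"
    using k(2) n by (intro exI[of _ "real k"]) auto
qed

lemma integer_grid_resolves:
  assumes cp: "coalescing_paths \<nat> r x y"
  shows "resolves \<nat> r x y a (real i) (real (Suc i))"
  unfolding resolves_def
proof (intro allI impI)
  fix s assume s: "first_meeting \<nat> r x y a s" "real i < s" "s \<le> real (Suc i)"
  then obtain k where "s = real k"
    by (auto simp: first_meeting_def elim: Nats_cases)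
  then have "s = real (Suc i)"
    using s by simp
  then show "y a (real (Suc i)) = x a (real (Suc i))"
    using coalescing_paths_at_first_meeting[OF cp s(1)] by simp
qed

definition time_grid :: "real set \<Rightarrow> real \<Rightarrow> nat \<Rightarrow> (nat \<Rightarrow> real) \<Rightarrow> bool" where
  "time_grid TT T n \<tau> \<longleftrightarrow> \<tau> 0 = 0 \<and> \<tau> n = T \<and> (\<forall>i\<le>n. \<tau> i \<in> TT) \<and> (\<forall>i<n. \<tau> i \<le> \<tau> (Suc i))"

text \<open>
  The grids are chosen once for all families of paths, as their law has to be computed; how fine a grid
  must be to resolve a given particle depends on the family. In discrete time one grid serves all.
\<close>

lemma resolving_grids:
  assumes "TT = \<nat> \<or> TT = {0..}" "T \<in> TT" "T > 0"
  obtains N :: "nat \<Rightarrow> nat" and \<tau> :: "nat \<Rightarrow> nat \<Rightarrow> real" where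
    "\<And>m. time_grid TT T (N m) (\<tau> m)"
    "\<And>r x y a. coalescing_paths TT r x y \<Longrightarrow> inj r \<Longrightarrow> (\<And>a. nearest_neighbour_path TT (x a)) \<Longrightarrow>
       first_meetings_exist TT r x y a \<and>
       (\<forall>\<^sub>F m in sequentially. \<forall>i<N m. resolves TT r x y a (\<tau> m i) (\<tau> m (Suc i)))"
proof (cases "TT = \<nat>")
  case True
  then obtain k where k: "T = real k"
    using assms(2) by (auto elim: Nats_cases)
  show ?thesis
    by (rule that[of "\<lambda>_. k" "\<lambda>_ i. real i"])
       (auto simp: time_grid_def k True first_meeting_attained_discrete integer_grid_resolves
          simp del: of_nat_Suc)
next
  case False
  then have TT: "TT = {0..}"
    using assms(1) by auto
  show ?thesis
  proof (rule that[of Suc "\<lambda>m i. real i * T / real (Suc m)"])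
    show "time_grid TT T (Suc m) (\<lambda>i. real i * T / real (Suc m))" for m
      using assms(3) by (auto simp: time_grid_def TT intro!: divide_right_mono mult_right_mono
          simp del: of_nat_Suc)
    fix r x y a
    assume *: "coalescing_paths TT r x y" "inj r" "\<And>a. nearest_neighbour_path TT (x a)"
    then have rc: "right_constant (x a)" for a
      using nearest_neighbour_right_constant by (simp add: TT)
    show "first_meetings_exist TT r x y a \<and> (\<forall>\<^sub>F m in sequentially. \<forall>i<Suc m.
        resolves TT r x y a (real i * T / real (Suc m)) (real (Suc i) * T / real (Suc m)))"
      unfolding TT using * rc coalescing_paths_right_constant[of r x y]
      by (auto simp: TT simp del: of_nat_Suc intro!: first_meeting_attained equidistant_grid_resolves)
  qed
qed

lemma coalescing_paths_start:
  assumes cp: "coalescing_paths TT r x y" and "0 \<in> TT" "\<And>t. t \<in> TT \<Longrightarrow> 0 \<le> t" "\<And>a. x a 0 = a"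
  shows "y a 0 = a"
proof (induction "r a" arbitrary: a rule: less_induct)
  case less
  have "x a s \<noteq> y b s" if "s \<in> TT" "s \<le> 0" "r b < r a" for s b
    using that assms(3)[of s] assms(4) less[of b] by force
  then have "y a 0 = x a 0"
    using cp[unfolded coalescing_paths_def, THEN conjunct1, rule_format, OF assms(2)] by auto
  then show ?case
    by (simp add: assms(4))
qed

section \<open>From paths to leaders on a grid\<close>

lemma leader_restr: "b \<in> F \<Longrightarrow> leader r F (restr F y) b = leader r F y b"
  unfolding leader_def by (rule arg_cong[of _ _ "arg_min r"]) (auto simp: restr_def)

text \<open>
  On a resolving grid the leader rule, applied to the free positions at the grid times only, reproduces
  the coalescing positions exactly.
\<close>

lemma coalescing_paths_on_grid:
  assumes cp: "coalescing_paths TT r x y" and fm: "\<And>a. first_meetings_exist TT r x y a" and "inj r"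
    and start: "\<And>a. y a 0 = a" and grid: "time_grid TT T n \<tau>"
    and F: "\<And>a c. a \<in> F \<Longrightarrow> r c < r a \<Longrightarrow> c \<in> F"
    and res: "\<And>a i. a \<in> F \<Longrightarrow> i < n \<Longrightarrow> resolves TT r x y a (\<tau> i) (\<tau> (Suc i))"
  shows "foldl (follow_leaders r F) (restr F (\<lambda>a. a)) (map (\<lambda>i. restr F (\<lambda>b. x b (\<tau> i))) [Suc 0..<Suc n])
       = restr F (\<lambda>b. y b T)"
proof -
  have "foldl (follow_leaders r F) (restr F (\<lambda>a. a)) (map (\<lambda>i. restr F (\<lambda>b. x b (\<tau> i))) [Suc 0..<Suc k])
      = restr F (\<lambda>b. y b (\<tau> k))" if "k \<le> n" for k
    using that
  proof (induction k)
    case 0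
    then show ?case
      using grid start by (simp add: time_grid_def)
  next
    case (Suc k)
    have step: "y b (\<tau> (Suc k)) = x (leader r F (\<lambda>a. y a (\<tau> k)) b) (\<tau> (Suc k))" if "b \<in> F" for b
      using grid Suc.prems res that F unfolding time_grid_def resolves_def
      by (intro coalescing_paths_follow_leader[OF cp fm \<open>inj r\<close>]) auto
    have "foldl (follow_leaders r F) (restr F (\<lambda>a. a)) (map (\<lambda>i. restr F (\<lambda>b. x b (\<tau> i))) [Suc 0..<Suc (Suc k)])
        = follow_leaders r F (restr F (\<lambda>b. y b (\<tau> k))) (restr F (\<lambda>b. x b (\<tau> (Suc k))))"
      using Suc by simp
    also have "\<dots> = restr F (\<lambda>b. y b (\<tau> (Suc k)))"
      unfolding follow_leaders_def
    proof (rule restr_cong)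
      fix b assume b: "b \<in> F"
      show "restr F (\<lambda>b. x b (\<tau> (Suc k))) (leader r F (restr F (\<lambda>b. y b (\<tau> k))) b) = y b (\<tau> (Suc k))"
        unfolding leader_restr[OF b] step[OF b]
        using leader_in[OF b, where r = r and y = "\<lambda>b. y b (\<tau> k)"] by (simp add: restr_def)
    qed
    finally show ?case .
  qed
  from this[of n] show ?thesis
    using grid by (simp add: time_grid_def)
qed

lemma time_grid_mem:
  assumes "time_grid TT T n \<tau>"
  shows "0 \<in> TT" "T \<in> TT"
  using assms unfolding time_grid_def by (metis le0, metis le_refl)

section \<open>The law of the coalescing system\<close>

lemma (in prob_space) independent_copies_start:
  assumes X: "independent_skip_free_copies M TT P X" and "0 \<in> TT"
  shows "AE \<omega> in M. \<forall>a. X a 0 \<omega> = a"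
  unfolding AE_all_countable
proof
  fix a
  have m: "markov_from M TT P a (X a)"
    using X by (simp add: independent_skip_free_copies_def)
  have "prob {\<omega> \<in> space M. X a 0 \<omega> = a} = 1"
    using m[unfolded markov_from_def, THEN conjunct2, rule_format, of "\<lambda>_. 0" "\<lambda>_. a" 0] assms(2) by simp
  moreover have "{\<omega> \<in> space M. X a 0 \<omega> = a} \<in> events"
    using m assms(2) by (auto simp: markov_from_def)
  ultimately show "AE \<omega> in M. X a 0 \<omega> = a"
    using prob_eq_1[of "{\<omega> \<in> space M. X a 0 \<omega> = a}"] by (auto elim: eventually_mono)
qed

text \<open>
  The free positions at the grid times form independent Markov chains. The initial positions are known,
  hence absent from \<open>L\<close>, but the finite-dimensional distributions of the processes include them.
\<close>

lemma (in prob_space) independent_copies_grid_law: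
  assumes X: "independent_skip_free_copies M TT P X" and grid: "time_grid TT T n \<tau>"
    and F: "finite F" "F \<noteq> {}"
    and l: "l \<in> set_pmf (free_chain (map (\<lambda>i. P (\<tau> i) (\<tau> (Suc i))) [0..<n]) F (\<lambda>a. a))"
  defines "L \<equiv> \<lambda>\<omega>. map (\<lambda>i. restr F (\<lambda>b. X b (\<tau> i) \<omega>)) [Suc 0..<Suc n]"
  shows "{\<omega> \<in> space M. L \<omega> = l} \<in> events \<and> prob {\<omega> \<in> space M. L \<omega> = l}
    = pmf (free_chain (map (\<lambda>i. P (\<tau> i) (\<tau> (Suc i))) [0..<n]) F (\<lambda>a. a)) l"
proof
  have markov: "markov_from M TT P b (X b)" for b
    using X by (simp add: independent_skip_free_copies_def)
  have [measurable]: "X b (\<tau> i) \<in> measurable M (count_space UNIV)" if "i \<le> n" for b i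
    using markov[of b] grid that by (auto simp: markov_from_def time_grid_def)
  have len: "length l = n" and supp: "\<And>x'. x' \<in> set l \<Longrightarrow> restr F x' = x'"
    using set_free_chain[OF F(1) l] by auto
  \<comment> \<open>\<open>l\<close> lists the positions at the grid times \<open>1, ..., n\<close>; time \<open>0\<close> is put in front.\<close>
  define \<xi> where "\<xi> = (\<lambda>i :: nat. if i = 0 then (\<lambda>a. a) else l ! (i - 1))"
  have l_eq: "l = map \<xi> [Suc 0..<Suc n]"
    by (rule nth_equalityI) (auto simp: \<xi>_def len simp del: upt_Suc)
  have supp': "restr F (\<xi> i) = \<xi> i" if "0 < i" "i \<le> n" for i
    using that supp by (auto simp: \<xi>_def len)
  have "L \<omega> = l \<longleftrightarrow> (\<forall>i\<in>{Suc 0..<Suc n}. restr F (\<lambda>b. X b (\<tau> i) \<omega>) = restr F (\<xi> i))" for \<omega>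
    unfolding L_def l_eq by (auto simp: supp' simp del: upt_Suc)
  also have "\<dots> \<omega> \<longleftrightarrow> (\<forall>i\<in>{Suc 0..<Suc n}. \<forall>b\<in>F. X b (\<tau> i) \<omega> = \<xi> i b)" for \<omega>
    by (auto simp: restr_def fun_eq_iff)
  finally have L_iff: "L \<omega> = l \<longleftrightarrow> (\<forall>i\<in>{Suc 0..<Suc n}. \<forall>b\<in>F. X b (\<tau> i) \<omega> = \<xi> i b)" for \<omega> .
  show meas: "{\<omega> \<in> space M. L \<omega> = l} \<in> events"
    unfolding L_iff using F(1) by (intro sets.sets_Collect_finite_All) auto
  \<comment> \<open>The event as a set of paths for each particle, in the form required by independence of whole paths.\<close>
  define A where "A = (\<lambda>b. {f \<in> space (Pi\<^sub>M TT (\<lambda>_. count_space UNIV :: int measure)). \<forall>i\<in>{..n}. f (\<tau> i) = \<xi> i b})"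
  have A: "A b \<in> sets (Pi\<^sub>M TT (\<lambda>_. count_space UNIV))" for b
  proof -
    have "(\<lambda>f. f (\<tau> i)) \<in> measurable (Pi\<^sub>M TT (\<lambda>_. count_space UNIV :: int measure)) (count_space UNIV)" if "i \<in> {..n}" for i
      using grid that by (intro measurable_component_singleton) (auto simp: time_grid_def)
    then show ?thesis
      unfolding A_def by (intro sets.sets_Collect_finite_All) auto
  qed
  have vimage: "(\<lambda>\<omega>. \<lambda>t\<in>TT. X b t \<omega>) -` A b \<inter> space M = {\<omega> \<in> space M. \<forall>i\<le>n. X b (\<tau> i) \<omega> = \<xi> i b}" for b
    using grid by (auto simp: A_def space_PiM time_grid_def)
  have "prob {\<omega> \<in> space M. L \<omega> = l} = prob (\<Inter>b\<in>F. (\<lambda>\<omega>. \<lambda>t\<in>TT. X b t \<omega>) -` A b \<inter> space M)"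
  proof (rule measure_eq_AE)
    have "AE \<omega> in M. \<forall>b. X b 0 \<omega> = b"
      by (rule independent_copies_start[OF X time_grid_mem(1)[OF grid]])
    then show "AE \<omega> in M. \<omega> \<in> {\<omega> \<in> space M. L \<omega> = l} \<longleftrightarrow> \<omega> \<in> (\<Inter>b\<in>F. (\<lambda>\<omega>. \<lambda>t\<in>TT. X b t \<omega>) -` A b \<inter> space M)"
    proof (rule AE_mp, intro AE_I2 impI)
      fix \<omega> assume \<omega>: "\<omega> \<in> space M" "\<forall>b. X b 0 \<omega> = b"
      have "X b (\<tau> 0) \<omega> = \<xi> 0 b" if "b \<in> F" for b
        using \<omega>(2) grid that by (simp add: \<xi>_def time_grid_def)
      then have "(\<forall>i\<in>{Suc 0..<Suc n}. X b (\<tau> i) \<omega> = \<xi> i b) \<longleftrightarrow> (\<forall>i\<le>n. X b (\<tau> i) \<omega> = \<xi> i b)" if "b \<in> F" for b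
        using that by (auto simp: Suc_le_eq less_Suc_eq_le)
      then show "\<omega> \<in> {\<omega> \<in> space M. L \<omega> = l} \<longleftrightarrow> \<omega> \<in> (\<Inter>b\<in>F. (\<lambda>\<omega>. \<lambda>t\<in>TT. X b t \<omega>) -` A b \<inter> space M)"
        unfolding vimage L_iff using \<omega>(1) F(2) by blast
    qed
    show "(\<Inter>b\<in>F. (\<lambda>\<omega>. \<lambda>t\<in>TT. X b t \<omega>) -` A b \<inter> space M) \<in> events"
    proof (intro sets.finite_INT F)
      fix b
      have "{\<omega> \<in> space M. \<forall>i\<in>{..n}. X b (\<tau> i) \<omega> = \<xi> i b} \<in> events"
        by (intro sets.sets_Collect_finite_All) auto
      then show "(\<lambda>\<omega>. \<lambda>t\<in>TT. X b t \<omega>) -` A b \<inter> space M \<in> events"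
        unfolding vimage by simp
    qed
  qed (rule meas)
  also have "\<dots> = (\<Prod>b\<in>F. prob ((\<lambda>\<omega>. \<lambda>t\<in>TT. X b t \<omega>) -` A b \<inter> space M))"
    using X F A by (intro indep_varsD[where I = UNIV]) (auto simp: independent_skip_free_copies_def)
  also have "\<dots> = (\<Prod>b\<in>F. \<Prod>i<n. pmf (P (\<tau> i) (\<tau> (Suc i)) (\<xi> i b)) (\<xi> (Suc i) b))"
  proof (rule prod.cong[OF refl])
    fix b
    show "prob ((\<lambda>\<omega>. \<lambda>t\<in>TT. X b t \<omega>) -` A b \<inter> space M) = (\<Prod>i<n. pmf (P (\<tau> i) (\<tau> (Suc i)) (\<xi> i b)) (\<xi> (Suc i) b))"
      unfolding vimage
      using markov[of b, unfolded markov_from_def, THEN conjunct2, rule_format, of \<tau> "\<lambda>i. \<xi> i b" n] grid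
      by (simp add: time_grid_def \<xi>_def)
  qed
  also have "\<dots> = (\<Prod>i=0..<n. \<Prod>b\<in>F. pmf (P (\<tau> i) (\<tau> (Suc i)) (\<xi> i b)) (\<xi> (Suc i) b))"
    by (subst prod.swap) (simp add: lessThan_atLeast0)
  also have "\<dots> = (\<Prod>i=0..<n. pmf (Pi_pmf F 0 (\<lambda>b. P (\<tau> i) (\<tau> (Suc i)) (\<xi> i b))) (\<xi> (Suc i)))"
  proof (intro prod.cong refl)
    fix i assume "i \<in> {0..<n}"
    then have "\<xi> (Suc i) b = 0" if "b \<notin> F" for b
      using supp'[of "Suc i"] that by (simp add: restr_def fun_eq_iff) metis
    then show "(\<Prod>b\<in>F. pmf (P (\<tau> i) (\<tau> (Suc i)) (\<xi> i b)) (\<xi> (Suc i) b))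
        = pmf (Pi_pmf F 0 (\<lambda>b. P (\<tau> i) (\<tau> (Suc i)) (\<xi> i b))) (\<xi> (Suc i))"
      using F(1) by (simp add: pmf_Pi')
  qed
  also have "\<dots> = pmf (free_chain (map (\<lambda>i. P (\<tau> i) (\<tau> (Suc i))) [0..<n]) F (\<xi> 0)) (map \<xi> [Suc 0..<Suc n])"
    by (subst pmf_free_chain) auto
  also have "\<dots> = pmf (free_chain (map (\<lambda>i. P (\<tau> i) (\<tau> (Suc i))) [0..<n]) F (\<lambda>a. a)) l"
    unfolding l_eq[symmetric] by (simp add: \<xi>_def)
  finally show "prob {\<omega> \<in> space M. L \<omega> = l}
      = pmf (free_chain (map (\<lambda>i. P (\<tau> i) (\<tau> (Suc i))) [0..<n]) F (\<lambda>a. a)) l" .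
qed

lemma markov_chain_grid:
  assumes P: "transition_function TT P" and grid: "time_grid TT T n \<tau>" and "j \<le> n"
  shows "markov_chain (map (\<lambda>i. P (\<tau> i) (\<tau> (Suc i))) [j..<n]) x = P (\<tau> j) T x"
  using assms(3)
proof (induction "n - j" arbitrary: j x)
  case 0
  with time_grid_mem(2)[OF grid] show ?case
    using P grid by (simp add: transition_function_def time_grid_def)
next
  case (Suc d)
  have mono: "\<tau> i \<le> \<tau> n" if "i \<le> n" for i
    using that
  proof (induction rule: inc_induct)
    case (step k)
    then show ?case
      using grid by (force simp: time_grid_def)
  qed simp
  have "[j..<n] = j # [Suc j..<n]"
    using Suc by (simp add: upt_conv_Cons)
  moreover have "markov_chain (map (\<lambda>i. P (\<tau> i) (\<tau> (Suc i))) [Suc j..<n]) = P (\<tau> (Suc j)) T"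
    by (rule ext, rule Suc.hyps(1)) (use Suc in auto)
  ultimately have "markov_chain (map (\<lambda>i. P (\<tau> i) (\<tau> (Suc i))) [j..<n]) x
      = bind_pmf (P (\<tau> j) (\<tau> (Suc j)) x) (P (\<tau> (Suc j)) T)"
    by simp
  also have "\<dots> = P (\<tau> j) T x"
  proof -
    have "\<tau> j \<in> TT" "\<tau> (Suc j) \<in> TT" "T \<in> TT" "\<tau> j \<le> \<tau> (Suc j)" "\<tau> (Suc j) \<le> T"
      using grid Suc mono[of "Suc j"] by (auto simp: time_grid_def)
    then show ?thesis
      using P by (simp add: transition_function_def)
  qed
  finally show ?case .
qed

text \<open>
  A grid with a single step from \<open>0\<close> to \<open>T\<close> gives the joint law of two final positions.
\<close>

lemma (in prob_space) prob_crossing_pmf: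
  assumes X: "independent_skip_free_copies M TT P X" and T: "0 \<in> TT" "T \<in> TT" "0 \<le> T" and "a \<noteq> b"
  shows "prob {\<omega> \<in> space M. X a T \<omega> \<ge> X b T \<omega>}
       = measure_pmf.prob (pair_pmf (P 0 T a) (P 0 T b)) {s. fst s \<ge> snd s}"
proof -
  define \<tau> where "\<tau> = (\<lambda>i :: nat. if i = 0 then 0 else T)"
  have grid: "time_grid TT T 1 \<tau>"
    using T by (auto simp: time_grid_def \<tau>_def)
  let ?F = "{a, b}"
  let ?Q = "free_chain (map (\<lambda>i. P (\<tau> i) (\<tau> (Suc i))) [0..<1]) ?F (\<lambda>a. a)"
  let ?L = "\<lambda>\<omega>. map (\<lambda>i. restr ?F (\<lambda>b. X b (\<tau> i) \<omega>)) [Suc 0..<Suc 1]"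
  let ?A = "{l. hd l a \<ge> hd l b}"
  obtain E where E: "E \<in> events" "AE \<omega> in M. \<omega> \<in> E \<longleftrightarrow> ?L \<omega> \<in> ?A" "prob E = measure_pmf.prob ?Q ?A"
    by (rule pmf_event[of ?Q ?L ?A]) (rule independent_copies_grid_law[OF X grid], auto)
  have [measurable]: "X c T \<in> measurable M (count_space UNIV)" for c
    using X T by (auto simp: independent_skip_free_copies_def markov_from_def)
  have "prob {\<omega> \<in> space M. X a T \<omega> \<ge> X b T \<omega>} = prob E"
  proof (rule measure_eq_AE)
    show "AE \<omega> in M. \<omega> \<in> {\<omega> \<in> space M. X a T \<omega> \<ge> X b T \<omega>} \<longleftrightarrow> \<omega> \<in> E"
      using E(2) by (rule AE_mp, intro AE_I2 impI) (auto simp: restr_def \<tau>_def)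
    show "{\<omega> \<in> space M. X a T \<omega> \<ge> X b T \<omega>} \<in> events"
      by measurable
  qed (rule E)
  also have "\<dots> = measure_pmf.prob (map_pmf (\<lambda>l. (hd l a, hd l b)) ?Q) {s. fst s \<ge> snd s}"
    by (simp add: E(3) vimage_def)
  also have "map_pmf (\<lambda>l. (hd l a, hd l b)) ?Q = map_pmf (\<lambda>f. (f a, f b)) (Pi_pmf ?F 0 (P 0 T))"
    by (simp add: \<tau>_def map_pmf_def bind_assoc_pmf bind_return_pmf)
  also have "\<dots> = pair_pmf (P 0 T a) (P 0 T b)"
    using \<open>a \<noteq> b\<close> by (simp add: Pi_pmf_insert' pair_pmf_def map_pmf_def bind_assoc_pmf bind_return_pmf)
  finally show ?thesis .
qed

text \<open>
  The reflection principle, with the final laws of the two chains identified by the Chapman-Kolmogorov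
  equations. The bound does not depend on the grid, so it survives its refinement.
\<close>

lemma (in prob_space) meeting_prob_le_crossing:
  assumes X: "independent_skip_free_copies M TT P X" and TT: "\<And>t. t \<in> TT \<Longrightarrow> 0 \<le> t"
    and grid: "time_grid TT T n \<tau>"
  shows "meeting_prob (map (\<lambda>i. P (\<tau> i) (\<tau> (Suc i))) [0..<n]) a b
     \<le> 2 * prob {\<omega> \<in> space M. X a T \<omega> \<ge> X b T \<omega>}"
proof (cases "a = b")
  case True
  then show ?thesis
    using meeting_prob_bounds[of "map (\<lambda>i. P (\<tau> i) (\<tau> (Suc i))) [0..<n]" a b] by (simp add: prob_space)
next
  case False
  have T: "0 \<in> TT" "T \<in> TT" "0 \<le> T"
    using time_grid_mem[OF grid] TT by auto
  have "transition_function TT P"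
    using X by (simp add: independent_skip_free_copies_def)
  from markov_chain_grid[OF this grid, of 0] grid
  have "markov_chain (map (\<lambda>i. P (\<tau> i) (\<tau> (Suc i))) [0..<n]) x = P 0 T x" for x
    by (simp add: time_grid_def)
  then show ?thesis
    using meeting_prob_reflection[of "map (\<lambda>i. P (\<tau> i) (\<tau> (Suc i))) [0..<n]" a b]
    by (simp add: prob_crossing_pmf[OF X T False])
qed

lemma (in prob_space) prob_tendsto_of_AE_eventually:
  assumes E: "\<And>m. E m \<in> events" "E' \<in> events" "AE \<omega> in M. \<forall>\<^sub>F m in sequentially. \<omega> \<in> E m \<longleftrightarrow> \<omega> \<in> E'"
  shows "(\<lambda>m. prob (E m)) \<longlonglongrightarrow> prob E'"
proof -
  have "(\<lambda>m. expectation (indicator (E m) :: _ \<Rightarrow> real)) \<longlonglongrightarrow> expectation (indicator E')"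
  proof (rule integral_dominated_convergence[where w = "\<lambda>_. 1"])
    show "AE \<omega> in M. (\<lambda>m. indicator (E m) \<omega> :: real) \<longlonglongrightarrow> indicator E' \<omega>"
      using E(3)
    proof (rule AE_mp, intro AE_I2 impI)
      fix \<omega> assume "\<forall>\<^sub>F m in sequentially. \<omega> \<in> E m \<longleftrightarrow> \<omega> \<in> E'"
      then have "\<forall>\<^sub>F m in sequentially. (indicator (E m) \<omega> :: real) = indicator E' \<omega>"
        by eventually_elim (simp add: indicator_def)
      then show "(\<lambda>m. indicator (E m) \<omega> :: real) \<longlonglongrightarrow> indicator E' \<omega>"
        by (rule tendsto_eventually)
    qed
  qed (use E in auto)
  then show ?thesis
    using E by simp
qed

text \<open>
  The bound holds for the coalescing flow on each grid, with a right-hand side that does not depend on the grid. On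
  fine grids the flow has the law of the coalescing system observed at time \<open>T\<close>, up to an error that vanishes in the
  limit: \<open>F\<close> contains all particles of rank up to the largest rank in \<open>F1 \<union> F2\<close>, so that \<open>F1\<close> and \<open>F2\<close>
  are determined by the free paths of the finite set \<open>F\<close>, and the consistency of the flow removes
  the additional particles again.
\<close>

lemma (in prob_space) coalescing_system_decoupling:
  assumes TT: "TT = \<nat> \<or> TT = {0..}" and T: "T \<in> TT" "T > 0"
    and X: "independent_skip_free_copies M TT P X" and Y: "coalescing_system M TT X Y"
    and fin: "finite F1" "finite F2"
    and EA: "{\<omega> \<in> space M. restr F1 (\<lambda>a. Y a T \<omega>) \<in> A} \<in> events" (is "?EA \<in> _")
    and EB: "{\<omega> \<in> space M. restr F2 (\<lambda>a. Y a T \<omega>) \<in> B} \<in> events" (is "?EB \<in> _")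
  shows "\<bar>prob (?EA \<inter> ?EB) - prob ?EA * prob ?EB\<bar>
    \<le> (\<Sum>a\<in>F1. \<Sum>b\<in>F2. 2 * prob {\<omega> \<in> space M. X a T \<omega> \<ge> X b T \<omega>})"
proof -
  have TT0: "0 \<in> TT" "\<And>t. t \<in> TT \<Longrightarrow> 0 \<le> t"
    using TT by (auto elim: Nats_cases)
  obtain r :: "int \<Rightarrow> nat" where r: "inj r"
    and cp: "AE \<omega> in M. coalescing_paths TT r (\<lambda>a t. X a t \<omega>) (\<lambda>a t. Y a t \<omega>)"
    using Y by (auto simp: coalescing_system_def)
  obtain N \<tau> where grid: "\<And>m. time_grid TT T (N m) (\<tau> m)"
    and fine: "\<And>r x y a. coalescing_paths TT r x y \<Longrightarrow> inj r \<Longrightarrow> (\<And>a. nearest_neighbour_path TT (x a)) \<Longrightarrow>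
       first_meetings_exist TT r x y a \<and>
       (\<forall>\<^sub>F m in sequentially. \<forall>i<N m. resolves TT r x y a (\<tau> m i) (\<tau> m (Suc i)))"
    using resolving_grids[OF TT T] by blast
  \<comment> \<open>The particles of rank at most \<open>R\<close> are all that can influence \<open>F1\<close> and \<open>F2\<close>.\<close>
  define R where "R = Max (insert 0 (r ` (F1 \<union> F2)))"
  define F where "F = {a. r a < Suc R}"
  have "r a \<le> R" if "a \<in> F1 \<union> F2" for a
    using fin that unfolding R_def by (intro Max_ge) auto
  then have F: "finite F" "F1 \<subseteq> F" "F2 \<subseteq> F"
    unfolding F_def using finite_lower_rank[OF r, of "Suc R"] by (auto simp: less_Suc_eq_le)
  have F_down: "c \<in> F" if "a \<in> F" "r c < r a" for a c
    using that by (simp add: F_def)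
  let ?ps = "\<lambda>m. map (\<lambda>i. P (\<tau> m i) (\<tau> m (Suc i))) [0..<N m]"
  let ?L = "\<lambda>m \<omega>. map (\<lambda>i. restr F (\<lambda>b. X b (\<tau> m i) \<omega>)) [Suc 0..<Suc (N m)]"
  let ?fl = "\<lambda>m. coalescing_flow (?ps m)"
  let ?lead = "foldl (follow_leaders r F) (restr F (\<lambda>a. a))"
  have good: "AE \<omega> in M. \<forall>\<^sub>F m in sequentially. ?lead (?L m \<omega>) = restr F (\<lambda>b. Y b T \<omega>)"
  proof -
    have "AE \<omega> in M. nearest_neighbour_path TT (\<lambda>t. X a t \<omega>)" for a
      using X by (simp add: independent_skip_free_copies_def)
    then have nn: "AE \<omega> in M. \<forall>a. nearest_neighbour_path TT (\<lambda>t. X a t \<omega>)"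
      by (simp add: AE_all_countable)
    have start: "AE \<omega> in M. \<forall>a. X a 0 \<omega> = a"
      by (rule independent_copies_start[OF X TT0(1)])
    show ?thesis
      using cp nn start
    proof eventually_elim
      case (elim \<omega>)
      let ?x = "\<lambda>a t. X a t \<omega>" and ?y = "\<lambda>a t. Y a t \<omega>"
      have f: "first_meetings_exist TT r ?x ?y a"
        "\<forall>\<^sub>F m in sequentially. \<forall>i<N m. resolves TT r ?x ?y a (\<tau> m i) (\<tau> m (Suc i))" for a
        using fine[OF elim(1) r, of a] elim(2) by auto
      have y0: "?y a 0 = a" for a
        using elim(3) by (intro coalescing_paths_start[OF elim(1) TT0]) auto
      have "\<forall>\<^sub>F m in sequentially. \<forall>a\<in>F. \<forall>i<N m. resolves TT r ?x ?y a (\<tau> m i) (\<tau> m (Suc i))"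
        using f(2) F(1) by (intro eventually_ball_finite) auto
      then show ?case
      proof eventually_elim
        case (elim m)
        show ?case
          using elim F_down
          by (intro coalescing_paths_on_grid[OF \<open>coalescing_paths TT r ?x ?y\<close> f(1) r y0 grid]) auto
      qed
    qed
  qed
  have lim: "(\<lambda>m. measure_pmf.prob (?fl m F (\<lambda>a. a)) C) \<longlonglongrightarrow> prob E"
    if E: "E \<in> events" "E = {\<omega> \<in> space M. restr F (\<lambda>b. Y b T \<omega>) \<in> C}" for E C
  proof (cases "F = {}")
    case True
    have "coalescing_flow ps {} y = return_pmf (\<lambda>_. 0)" for ps and y :: "int \<Rightarrow> int"
      by (induction ps arbitrary: y) (simp_all add: restr_def coalescing_step_def map_pmf_const bind_return_pmf)
    moreover have "E = (if (\<lambda>_. 0) \<in> C then space M else {})"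
      using E(2) True by (auto simp: restr_def)
    ultimately show ?thesis
      using True by (simp add: prob_space indicator_def)
  next
    case False
    have "\<exists>E'. E' \<in> events \<and> (AE \<omega> in M. \<omega> \<in> E' \<longleftrightarrow> ?lead (?L m \<omega>) \<in> C) \<and>
        prob E' = measure_pmf.prob (?fl m F (\<lambda>a. a)) C" for m
    proof -
      let ?Q = "free_chain (?ps m) F (\<lambda>a. a)"
      \<comment> \<open>Initially the sites are distinct and every particle leads itself.\<close>
      have inv: "restr F (\<lambda>a. a) b = leader r F (restr F (\<lambda>a. a)) b" if "b \<in> F" for b
      proof -
        have "leader r F (restr F (\<lambda>a. a)) b = leader r F (\<lambda>a. a) b"
          by (rule leader_restr[OF that])
        also have "\<dots> = b"
          using leader_value[OF that, where r = r and y = "\<lambda>a. a"] by simp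
        finally show ?thesis
          using that by (simp add: restr_def)
      qed
      have law: "map_pmf ?lead ?Q = ?fl m F (\<lambda>a. a)"
        by (subst follow_leaders_chain_law[where y = "restr F (\<lambda>a. a)" and x = "\<lambda>a. a", OF F(1) r _ inv])
           (auto simp: restr_def intro!: coalescing_flow_cong)
      obtain E' where "E' \<in> events" "AE \<omega> in M. \<omega> \<in> E' \<longleftrightarrow> ?L m \<omega> \<in> ?lead -` C"
        "prob E' = measure_pmf.prob ?Q (?lead -` C)"
        by (rule pmf_event[of ?Q "?L m" "?lead -` C"]) (rule independent_copies_grid_law[OF X grid F(1) False])
      then show ?thesis
        unfolding law[symmetric] measure_map_pmf vimage_eq by (intro exI[of _ E'] conjI)
    qed
    then have "\<forall>m. \<exists>E'. E' \<in> events \<and> (AE \<omega> in M. \<omega> \<in> E' \<longleftrightarrow> ?lead (?L m \<omega>) \<in> C) \<and>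
        prob E' = measure_pmf.prob (?fl m F (\<lambda>a. a)) C"
      by (rule allI)
    from choice[OF this] obtain E' where E': "\<And>m. E' m \<in> events" "\<And>m. AE \<omega> in M. \<omega> \<in> E' m \<longleftrightarrow> ?lead (?L m \<omega>) \<in> C"
      "\<And>m. prob (E' m) = measure_pmf.prob (?fl m F (\<lambda>a. a)) C"
      by blast
    have "AE \<omega> in M. \<forall>m. \<omega> \<in> E' m \<longleftrightarrow> ?lead (?L m \<omega>) \<in> C"
      unfolding AE_all_countable by (intro allI E'(2))
    with good AE_space have "AE \<omega> in M. \<forall>\<^sub>F m in sequentially. \<omega> \<in> E' m \<longleftrightarrow> \<omega> \<in> E"
    proof eventually_elim
      case (elim \<omega>)
      from elim(1) show ?case
        by eventually_elim (use elim(2,3) in \<open>simp add: E(2)\<close>)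
    qed
    then show ?thesis
      using prob_tendsto_of_AE_eventually[of E' E, OF E'(1) E(1)] unfolding E'(3) by blast
  qed
  have marg: "measure_pmf.prob (?fl m F (\<lambda>a. a)) {z. restr G z \<in> C} = measure_pmf.prob (?fl m G (\<lambda>a. a)) C"
    if "G \<subseteq> F" for G C m
    unfolding coalescing_flow_restr[OF F(1) that, of "?ps m" "\<lambda>a. a", symmetric]
    by (simp add: vimage_def)
  have joint: "measure_pmf.prob (?fl m F (\<lambda>a. a)) {z. restr F1 z \<in> A \<and> restr F2 z \<in> B}
      = measure_pmf.prob (?fl m (F1 \<union> F2) (\<lambda>a. a)) {z. restr F1 z \<in> A \<and> restr F2 z \<in> B}" for m
    using marg[of "F1 \<union> F2" m "{z. restr F1 z \<in> A \<and> restr F2 z \<in> B}"] F(2,3)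
    by (simp add: Int_absorb2 Int_Un_distrib)
  have lim1: "(\<lambda>m. measure_pmf.prob (?fl m F1 (\<lambda>a. a)) A) \<longlonglongrightarrow> prob ?EA"
    unfolding marg[OF F(2), symmetric] by (rule lim[OF EA]) (simp add: Int_absorb2 F(2))
  have lim2: "(\<lambda>m. measure_pmf.prob (?fl m F2 (\<lambda>a. a)) B) \<longlonglongrightarrow> prob ?EB"
    unfolding marg[OF F(3), symmetric] by (rule lim[OF EB]) (simp add: Int_absorb2 F(3))
  have lim3: "(\<lambda>m. measure_pmf.prob (?fl m (F1 \<union> F2) (\<lambda>a. a)) {z. restr F1 z \<in> A \<and> restr F2 z \<in> B})
      \<longlonglongrightarrow> prob (?EA \<inter> ?EB)"
    unfolding joint[symmetric] by (rule lim[OF sets.Int[OF EA EB]]) (auto simp: Int_absorb2 F(2,3))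
  have bound: "\<bar>measure_pmf.prob (?fl m (F1 \<union> F2) (\<lambda>a. a)) {z. restr F1 z \<in> A \<and> restr F2 z \<in> B}
        - measure_pmf.prob (?fl m F1 (\<lambda>a. a)) A * measure_pmf.prob (?fl m F2 (\<lambda>a. a)) B\<bar>
      \<le> (\<Sum>a\<in>F1. \<Sum>b\<in>F2. 2 * prob {\<omega> \<in> space M. X a T \<omega> \<ge> X b T \<omega>})" for m
    by (rule order_trans[OF coalescing_flow_decoupling[OF fin]])
       (intro sum_mono meeting_prob_le_crossing[OF X TT0(2) grid])
  show ?thesis
    by (rule LIMSEQ_le_const2[OF tendsto_rabs[OF tendsto_diff[OF lim3 tendsto_mult[OF lim1 lim2]]]])
       (use bound in blast)
qed

section \<open>Mixing of the walls\<close>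

text \<open>
  The mixed moments of the wall indicators. A repeated index counts once, since an indicator equals its
  square.
\<close>

definition wall_moment :: "'w measure \<Rightarrow> (int \<Rightarrow> 'w \<Rightarrow> int) \<Rightarrow> int list \<Rightarrow> real" where
  "wall_moment M Z xs = measure M {\<omega> \<in> space M. \<forall>i\<in>set xs. Z i \<omega> \<noteq> Z (i + 1) \<omega>}"

text \<open>
  The walls with index in \<open>I\<close> are determined by the particles from \<open>I\<close> and from the right neighbours of
  \<open>I\<close>. If every index of \<open>J\<close> exceeds every index of \<open>I\<close> by more than \<open>g\<close>, the particles for \<open>J\<close> start at
  distance at least \<open>g\<close> from those for \<open>I\<close>, and there are at most \<open>(2 k)\<^sup>2\<close> pairs to consider.
\<close>

lemma (in prob_space) wall_moment_mixing:
  assumes TT: "TT = \<nat> \<or> TT = {0..}" and T: "T \<in> TT" "T > 0"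
    and X: "independent_skip_free_copies M TT P X" and Y: "coalescing_system M TT X Y"
    and decay: "\<And>N :: nat. \<exists>C\<ge>0. \<forall>a b. a < b \<longrightarrow>
        prob {\<omega> \<in> space M. X a T \<omega> \<ge> X b T \<omega>} \<le> C / real_of_int (b - a) ^ N"
  shows "\<exists>C\<ge>0. \<forall>p g ys. g \<ge> 1 \<longrightarrow> length ys \<le> k \<longrightarrow> (\<forall>y\<in>set ys. y \<le> p \<or> y > p + g) \<longrightarrow>
      factor_error (wall_moment M (\<lambda>a. Y a T)) (\<lambda>y. y \<le> p) ys \<le> C / real_of_int g ^ N"
proof -
  obtain C where C: "C \<ge> 0" "\<And>a b. a < b \<Longrightarrow>
      prob {\<omega> \<in> space M. X a T \<omega> \<ge> X b T \<omega>} \<le> C / real_of_int (b - a) ^ N"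
    using decay[of N] by blast
  have [measurable]: "Y a T \<in> measurable M (count_space UNIV)" for a
    using Y T by (simp add: coalescing_system_def)
  have "factor_error (wall_moment M (\<lambda>a. Y a T)) (\<lambda>y. y \<le> p) ys \<le> (8 * real k ^ 2 * C) / real_of_int g ^ N"
    if g: "g \<ge> 1" and len: "length ys \<le> k" and gap: "\<forall>y\<in>set ys. y \<le> p \<or> y > p + g" for p g ys
  proof -
    define nbhd :: "int set \<Rightarrow> int set" where "nbhd = (\<lambda>I. I \<union> (\<lambda>i. i + 1) ` I)"
    define all_walls :: "int set \<Rightarrow> (int \<Rightarrow> int) set" where "all_walls = (\<lambda>I. {z. \<forall>i\<in>I. z i \<noteq> z (i + 1)})"
    define I where "I = {y \<in> set ys. y \<le> p}"
    define J where "J = {y \<in> set ys. \<not> y \<le> p}"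
    have IJ: "finite I" "finite J" "I \<union> J = set ys"
      by (auto simp: I_def J_def)
    have card_nbhd: "finite (nbhd H) \<and> real (card (nbhd H)) \<le> 2 * real k" if "H \<subseteq> set ys" for H
    proof
      have H: "finite H"
        using that finite_subset by auto
      then show "finite (nbhd H)"
        by (simp add: nbhd_def)
      have "card (nbhd H) \<le> card H + card ((\<lambda>i. i + 1) ` H)"
        unfolding nbhd_def by (rule card_Un_le)
      also have "\<dots> \<le> card H + card H"
        using card_image_le[OF H] by simp
      also have "\<dots> \<le> 2 * k"
        using card_mono[OF _ that] card_length[of ys] len by simp
      finally show "real (card (nbhd H)) \<le> 2 * real k"
        by linarith
    qed
    have wall_event: "{\<omega> \<in> space M. restr (nbhd H) (\<lambda>a. Y a T \<omega>) \<in> all_walls H}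
        = {\<omega> \<in> space M. \<forall>i\<in>H. Y i T \<omega> \<noteq> Y (i + 1) T \<omega>}" for H
      by (auto simp: restr_def nbhd_def all_walls_def)
    have meas: "{\<omega> \<in> space M. \<forall>i\<in>H. Y i T \<omega> \<noteq> Y (i + 1) T \<omega>} \<in> events" if "finite H" for H
      using that by (intro sets.sets_Collect_finite_All) auto
    have "factor_error (wall_moment M (\<lambda>a. Y a T)) (\<lambda>y. y \<le> p) ys =
       \<bar>prob ({\<omega> \<in> space M. restr (nbhd I) (\<lambda>a. Y a T \<omega>) \<in> all_walls I}
            \<inter> {\<omega> \<in> space M. restr (nbhd J) (\<lambda>a. Y a T \<omega>) \<in> all_walls J})
         - prob {\<omega> \<in> space M. restr (nbhd I) (\<lambda>a. Y a T \<omega>) \<in> all_walls I}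
           * prob {\<omega> \<in> space M. restr (nbhd J) (\<lambda>a. Y a T \<omega>) \<in> all_walls J}\<bar>"
    proof -
      have "{\<omega> \<in> space M. \<forall>i\<in>I. Y i T \<omega> \<noteq> Y (i + 1) T \<omega>} \<inter> {\<omega> \<in> space M. \<forall>i\<in>J. Y i T \<omega> \<noteq> Y (i + 1) T \<omega>}
          = {\<omega> \<in> space M. \<forall>i\<in>set ys. Y i T \<omega> \<noteq> Y (i + 1) T \<omega>}"
        unfolding IJ(3)[symmetric] by auto
      then show ?thesis
        unfolding wall_event factor_error_def wall_moment_def by (simp add: I_def J_def)
    qed
    also have "\<dots> \<le> (\<Sum>a\<in>nbhd I. \<Sum>b\<in>nbhd J. 2 * prob {\<omega> \<in> space M. X a T \<omega> \<ge> X b T \<omega>})"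
      by (rule coalescing_system_decoupling[OF TT T X Y])
         (use card_nbhd[of I] card_nbhd[of J] in \<open>auto simp: wall_event meas IJ I_def J_def\<close>)
    also have "\<dots> \<le> (\<Sum>a\<in>nbhd I. \<Sum>b\<in>nbhd J. 2 * (C / real_of_int g ^ N))"
    proof (intro sum_mono mult_left_mono)
      fix a b assume "a \<in> nbhd I" "b \<in> nbhd J"
      then have ab: "g \<le> b - a"
        using gap g by (force simp: nbhd_def I_def J_def)
      have "prob {\<omega> \<in> space M. X a T \<omega> \<ge> X b T \<omega>} \<le> C / real_of_int (b - a) ^ N"
        using ab g by (intro C) auto
      also have "\<dots> \<le> C / real_of_int g ^ N"
        using ab g C(1) by (intro divide_left_mono power_mono mult_pos_pos zero_less_power) auto
      finally show "prob {\<omega> \<in> space M. X a T \<omega> \<ge> X b T \<omega>} \<le> C / real_of_int g ^ N" .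
    qed auto
    also have "\<dots> = (real (card (nbhd I)) * real (card (nbhd J))) * (2 * (C / real_of_int g ^ N))"
      by simp
    also have "\<dots> \<le> ((2 * real k) * (2 * real k)) * (2 * (C / real_of_int g ^ N))"
      using C(1) g card_nbhd[of I] card_nbhd[of J] by (intro mult_right_mono mult_mono) (auto simp: I_def J_def)
    also have "\<dots> = (8 * real k ^ 2 * C) / real_of_int g ^ N"
      by (simp add: power2_eq_square)
    finally show ?thesis .
  qed
  then show ?thesis
    using C(1) by (intro exI[of _ "8 * real k ^ 2 * C"]) auto
qed

text \<open>
  The terms of a convergent series of nonnegative numbers are bounded by its sum.
\<close>

lemma (in prob_space) polynomial_crossing_decay:
  fixes V :: "int \<Rightarrow> 'a \<Rightarrow> int"
  assumes "summable (\<lambda>n. real (Suc n) ^ N * (SUP a. prob {\<omega> \<in> space M. V a \<omega> \<ge> V (a + int (Suc n)) \<omega>}))"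
  shows "\<exists>C\<ge>0. \<forall>a b. a < b \<longrightarrow> prob {\<omega> \<in> space M. V a \<omega> \<ge> V b \<omega>} \<le> C / real_of_int (b - a) ^ N"
proof -
  define q where "q = (\<lambda>n a. prob {\<omega> \<in> space M. V a \<omega> \<ge> V (a + int (Suc n)) \<omega>})"
  define f where "f = (\<lambda>n. real (Suc n) ^ N * (SUP a. q n a))"
  have f: "summable f"
    using assms by (simp add: f_def q_def)
  have bdd: "bdd_above (range (q n))" for n
    by (rule bdd_aboveI[of _ 1]) (auto simp: q_def)
  have q_le: "q n a \<le> (SUP a. q n a)" for n a
    by (rule cSUP_upper[OF UNIV_I bdd])
  have "0 \<le> (SUP a. q n a)" for n
    using q_le[of n 0] measure_nonneg[of M] unfolding q_def by (meson order_trans)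
  then have f0: "0 \<le> f n" for n
    by (simp add: f_def)
  have "prob {\<omega> \<in> space M. V a \<omega> \<ge> V b \<omega>} \<le> suminf f / real_of_int (b - a) ^ N" if "a < b" for a b
  proof -
    define n where "n = nat (b - a - 1)"
    have n: "int (Suc n) = b - a"
      using that by (simp add: n_def)
    then have nr: "real_of_int (b - a) = real (Suc n)"
      by (metis of_int_of_nat_eq)
    have b: "a + int (Suc n) = b"
      using n by simp
    have "real (Suc n) ^ N * q n a \<le> f n"
      unfolding f_def by (intro mult_left_mono q_le) auto
    also have "\<dots> \<le> suminf f"
      using sum_le_suminf[OF f, of "{n}"] f0 by simp
    finally have "q n a \<le> suminf f / real (Suc n) ^ N"
      by (simp add: field_simps del: of_nat_Suc)
    then show ?thesis
      unfolding nr by (simp only: q_def b)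
  qed
  moreover have "0 \<le> suminf f"
    by (rule suminf_nonneg[OF f f0])
  ultimately show ?thesis
    by blast
qed

section \<open>Cumulants of the number of walls\<close>

text \<open>
  A wall at \<open>i + 1/2\<close> lies in \<open>[0, L]\<close> exactly for the integers \<open>i\<close> from \<open>0\<close> to \<open>L - 1/2\<close>.
\<close>

lemma num_walls_eq:
  "num_walls y L = (\<Sum>i\<in>{0..\<lfloor>L - 1 / 2\<rfloor>}. if y i \<noteq> y (i + 1) then 1 else 0)"
proof -
  define J where "J = {i \<in> {0..\<lfloor>L - 1 / 2\<rfloor>}. y i \<noteq> y (i + 1)}"
  have "walls y \<inter> {0..L} = (\<lambda>i. real_of_int i + 1 / 2) ` J"
  proof (intro set_eqI iffI)
    fix w assume "w \<in> walls y \<inter> {0..L}"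
    then obtain i where i: "y i \<noteq> y (i + 1)" "w = real_of_int i + 1 / 2" "0 \<le> w" "w \<le> L"
      by (auto simp: walls_def basin_def)
    have "- 1 < real_of_int i"
      using i by linarith
    then have "0 \<le> i"
      by linarith
    moreover have "i \<le> \<lfloor>L - 1 / 2\<rfloor>"
      using i by (simp add: le_floor_iff)
    ultimately show "w \<in> (\<lambda>i. real_of_int i + 1 / 2) ` J"
      using i by (auto simp: J_def)
  next
    fix w assume "w \<in> (\<lambda>i. real_of_int i + 1 / 2) ` J"
    then show "w \<in> walls y \<inter> {0..L}"
      by (auto simp: J_def walls_def basin_def le_floor_iff)
  qed
  then have "num_walls y L = card J"
    unfolding num_walls_def by (simp add: card_image inj_on_def)
  also have "\<dots> = (\<Sum>i\<in>{0..\<lfloor>L - 1 / 2\<rfloor>}. if y i \<noteq> y (i + 1) then 1 else 0)"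
    unfolding J_def by (subst sum.If_cases) (auto simp: Int_def)
  finally show ?thesis .
qed

lemma (in prob_space) expectation_tuple_sum:
  assumes "finite I" "\<And>xs. length xs = n \<Longrightarrow> integrable M (\<lambda>\<omega>. f \<omega> xs)"
  shows "integrable M (\<lambda>\<omega>. tuple_sum I n (f \<omega>)) \<and>
     expectation (\<lambda>\<omega>. tuple_sum I n (f \<omega>)) = tuple_sum I n (\<lambda>xs. expectation (\<lambda>\<omega>. f \<omega> xs))"
  using assms(2)
proof (induction n arbitrary: f)
  case (Suc n)
  have "integrable M (\<lambda>\<omega>. tuple_sum I n (\<lambda>xs. f \<omega> (x # xs))) \<and>
     expectation (\<lambda>\<omega>. tuple_sum I n (\<lambda>xs. f \<omega> (x # xs))) = tuple_sum I n (\<lambda>xs. expectation (\<lambda>\<omega>. f \<omega> (x # xs)))" for x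
    by (rule Suc.IH) (use Suc.prems in auto)
  then show ?case
    by simp
qed auto

lemma (in prob_space) wall_count_moment:
  assumes [measurable]: "\<And>a. Z a \<in> measurable M (count_space UNIV)" and "finite I"
  shows "expectation (\<lambda>\<omega>. real (\<Sum>i\<in>I. if Z i \<omega> \<noteq> Z (i + 1) \<omega> then 1 else 0) ^ n)
    = tuple_sum I n (wall_moment M Z)"
proof -
  define w where "w = (\<lambda>\<omega> i. if Z i \<omega> \<noteq> Z (i + 1) \<omega> then 1 else 0 :: real)"
  have prod_w: "(\<Prod>i\<leftarrow>xs. w \<omega> i) = indicator {\<omega> \<in> space M. \<forall>i\<in>set xs. Z i \<omega> \<noteq> Z (i + 1) \<omega>} \<omega>"
    if "\<omega> \<in> space M" for \<omega> xs
    using that by (induction xs) (auto simp: w_def indicator_def)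
  have meas: "{\<omega> \<in> space M. \<forall>i\<in>set xs. Z i \<omega> \<noteq> Z (i + 1) \<omega>} \<in> events" for xs :: "int list"
    by (intro sets.sets_Collect_finite_All) auto
  have moment: "expectation (\<lambda>\<omega>. \<Prod>i\<leftarrow>xs. w \<omega> i) = wall_moment M Z xs" for xs
    unfolding wall_moment_def
    by (subst Bochner_Integration.integral_cong[OF refl prod_w]) (use meas in auto)
  have int: "integrable M (\<lambda>\<omega>. \<Prod>i\<leftarrow>xs. w \<omega> i)" for xs
    by (subst Bochner_Integration.integrable_cong[OF refl prod_w])
       (use meas in \<open>auto intro!: integrable_real_indicator simp: emeasure_eq_measure\<close>)
  have "real (\<Sum>i\<in>I. if Z i \<omega> \<noteq> Z (i + 1) \<omega> then 1 else 0) ^ n = tuple_sum I n (\<lambda>xs. \<Prod>i\<leftarrow>xs. w \<omega> i)" for \<omega>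
    unfolding tuple_sum_prod_list by (simp add: w_def if_distrib cong: if_cong)
  then have "expectation (\<lambda>\<omega>. real (\<Sum>i\<in>I. if Z i \<omega> \<noteq> Z (i + 1) \<omega> then 1 else 0) ^ n)
      = expectation (\<lambda>\<omega>. tuple_sum I n (\<lambda>xs. \<Prod>i\<leftarrow>xs. w \<omega> i))"
    by simp
  also have "\<dots> = tuple_sum I n (wall_moment M Z)"
    using expectation_tuple_sum[OF assms(2), of n "\<lambda>\<omega> xs. \<Prod>i\<leftarrow>xs. w \<omega> i"] int
    by (simp add: moment)
  finally show ?thesis .
qed

text \<open>
  Both sides satisfy the recursion that recovers the cumulants from the moments.
\<close>

lemma (in prob_space) wall_count_cumulant:
  assumes Z: "\<And>a. Z a \<in> measurable M (count_space UNIV)" and "finite I"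
  shows "cumulant M (Suc n) (\<lambda>\<omega>. real (\<Sum>i\<in>I. if Z i \<omega> \<noteq> Z (i + 1) \<omega> then 1 else 0))
    = tuple_sum I (Suc n) (joint_cumulant (wall_moment M Z))"
proof -
  let ?S = "\<lambda>\<omega>. \<Sum>i\<in>I. if Z i \<omega> \<noteq> Z (i + 1) \<omega> then 1 else 0 :: nat"
  note [measurable] = Z
  have S: "?S \<in> measurable M (count_space UNIV)" "?S \<omega> \<le> card I" for \<omega>
  proof -
    show "?S \<in> measurable M (count_space UNIV)"
      by measurable
    show "?S \<omega> \<le> card I"
      using sum_bounded_above[of I "\<lambda>i. if Z i \<omega> \<noteq> Z (i + 1) \<omega> then 1 else 0 :: nat" 1] by simp
  qed
  have moment: "expectation (\<lambda>\<omega>. real (?S \<omega>) ^ j) = tuple_sum I j (wall_moment M Z)" for j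
    by (rule wall_count_moment[OF assms])
  have E: "wall_moment M Z [] = 1"
    by (simp add: wall_moment_def prob_space)
  show ?thesis
  proof (rule cumulant_recursion_unique[where m = "\<lambda>n. tuple_sum I n (wall_moment M Z)"
      and c = "\<lambda>j. cumulant M j (\<lambda>\<omega>. real (?S \<omega>))"
      and c' = "\<lambda>j. tuple_sum I j (joint_cumulant (wall_moment M Z))"])
    fix n
    show "tuple_sum I (Suc n) (wall_moment M Z) = (\<Sum>j\<le>n. real (n choose j)
        * cumulant M (Suc j) (\<lambda>\<omega>. real (?S \<omega>)) * tuple_sum I (n - j) (wall_moment M Z))"
      using cumulant_moment_recursion[OF S, of n] by (simp only: moment)
    show "tuple_sum I (Suc n) (wall_moment M Z) = (\<Sum>j\<le>n. real (n choose j)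
        * tuple_sum I (Suc j) (joint_cumulant (wall_moment M Z)) * tuple_sum I (n - j) (wall_moment M Z))"
      by (rule tuple_sum_moment_recursion[where E = "wall_moment M Z", OF E])
  qed (simp add: E)
qed

theorem theorem4p1:
  fixes M :: "'w measure"
    and TT :: "real set"
    and P :: "real \<Rightarrow> real \<Rightarrow> int \<Rightarrow> int pmf"
    and X Y :: "int \<Rightarrow> real \<Rightarrow> 'w \<Rightarrow> int"
    and T :: real
    and k :: nat
  assumes "prob_space M"
    and "TT = \<nat> \<or> TT = {0..}"
    and "independent_skip_free_copies M TT P X"
    and "coalescing_system M TT X Y"
    and "T \<in> TT" and "T > 0"
    and "\<And>N :: nat. summable (\<lambda>n. real (Suc n) ^ N *
           (SUP a :: int. measure M {\<omega> \<in> space M. X a T \<omega> \<ge> X (a + int (Suc n)) T \<omega>}))"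
    and "k \<ge> 2"
  shows "(\<lambda>L :: real. cumulant M k (\<lambda>\<omega>. real (num_walls (\<lambda>a. Y a T \<omega>) L))) \<in> O(\<lambda>L. L)"
proof -
  interpret prob_space M
    by fact
  let ?E = "wall_moment M (\<lambda>a. Y a T)"
  obtain n where n: "k = Suc n"
    using \<open>k \<ge> 2\<close> by (cases k) auto
  have Y: "Y a T \<in> measurable M (count_space UNIV)" for a
    using assms(4,5) by (simp add: coalescing_system_def)
  have decay: "\<exists>C\<ge>0. \<forall>a b. a < b \<longrightarrow>
      prob {\<omega> \<in> space M. X a T \<omega> \<ge> X b T \<omega>} \<le> C / real_of_int (b - a) ^ N" for N
    by (rule polynomial_crossing_decay[OF assms(7)])
  have E: "?E [] = 1" "\<bar>?E xs\<bar> \<le> 1" for xs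
    by (simp_all add: wall_moment_def prob_space)
  obtain C where C: "C \<ge> 0" "\<And>I. finite I \<Longrightarrow> \<bar>tuple_sum I k (joint_cumulant ?E)\<bar> \<le> C * real (card I)"
    using tuple_sum_joint_cumulant_linear[of ?E n, OF E
        wall_moment_mixing[OF assms(2,5,6,3,4) decay]] n by blast
  have "\<forall>\<^sub>F L in at_top. norm (cumulant M k (\<lambda>\<omega>. real (num_walls (\<lambda>a. Y a T \<omega>) L))) \<le> (2 * C) * norm L"
    using eventually_ge_at_top[of "1 :: real"]
  proof eventually_elim
    case (elim L)
    let ?I = "{0..\<lfloor>L - 1 / 2\<rfloor>}"
    have "real (card ?I) \<le> 2 * L"
    proof -
      have "real (card ?I) = real_of_int (\<lfloor>L - 1 / 2\<rfloor> + 1)"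
        using elim by simp
      also have "\<dots> \<le> 2 * L"
        using elim by linarith
      finally show ?thesis .
    qed
    then have "C * real (card ?I) \<le> C * (2 * L)"
      using C(1) by (rule mult_left_mono)
    moreover have "cumulant M k (\<lambda>\<omega>. real (num_walls (\<lambda>a. Y a T \<omega>) L)) = tuple_sum ?I k (joint_cumulant ?E)"
      unfolding num_walls_eq n by (rule wall_count_cumulant[OF Y]) simp
    ultimately show ?case
      using C(2)[of ?I] elim by simp
  qed
  then show ?thesis
    by (rule bigoI)
qed

end
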